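(* For a real number $\varepsilon>0$ and a real number $N$, let $B_{\varepsilon}(N)$ denote the set of binary integers $m<N$ for which $\theta_m<m^{1/2+\varepsilon}$, where $\theta_m$ is the number of nonzero terms of the cyclotomic polynomial $\Phi_m$. Then, as $N\to\infty$ with $\varepsilon$ fixed: (1) for every $\varepsilon$ with $0<\varepsilon<1/2$, $\#B_{\varepsilon}(N)=\Omega(N^{1/2})$; (2) for every $\varepsilon$ with $0<\varepsilon<1/6$, $\#B_{\varepsilon}(N)=O(N^{1/2+\varepsilon})$; (3) for every $\varepsilon$ with $0<\varepsilon<1/2$, $\#B_{\varepsilon}(N)=O(N/\log^2 N)$. The implied constants may depend on $\varepsilon$.
   Context: The $m$th cyclotomic polynomial $\Phi_m\in\mathbb{Z}[x]$ is the monic polynomial of minimal degree having all the primitive $m$th roots of unity as its zeros. A positive integer $m$ is called binary if $m$ is a product of two distinct odd primes. For binary $m$, $\theta_m$ denotes the number of nonzero terms of $\Phi_m$, i.e. the number of exponents $k$ such that the coefficient of $x^k$ in $\Phi_m$ is nonzero. $\#S$ denotes the cardinality of a finite set $S$. Asymptotic notation: for nonnegative functions $f,g$ of $N$, $f(N)=O(g(N))$ means that there are constants $C>0$ and $N_0$ with $f(N)\le C g(N)$ for all $N\ge N_0$; $f(N)=\Omega(g(N))$ means that there are constants $c>0$ and $N_0$ with $f(N)\ge c\, g(N)$ for all $N\ge N_0$. *)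

theory Defs
  imports
    "HOL-Computational_Algebra.Computational_Algebra"
    "HOL-Library.Landau_Symbols"
begin

definition primitive_root_of_unity :: "nat \<Rightarrow> complex \<Rightarrow> bool" where
  "primitive_root_of_unity m z \<longleftrightarrow>
     m > 0 \<and> z ^ m = 1 \<and> (\<forall>k. 0 < k \<and> k < m \<longrightarrow> z ^ k \<noteq> 1)"

definition vanishes_at_primitive_roots :: "nat \<Rightarrow> int poly \<Rightarrow> bool" where
  "vanishes_at_primitive_roots m p \<longleftrightarrow>
     (\<forall>z. primitive_root_of_unity m z \<longrightarrow> poly (map_poly of_int p) z = 0)"

definition is_cyclotomic_poly :: "nat \<Rightarrow> int poly \<Rightarrow> bool" where
  "is_cyclotomic_poly m p \<longleftrightarrow>
     lead_coeff p = 1 \<and> vanishes_at_primitive_roots m p \<and>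
     (\<forall>q. lead_coeff q = 1 \<and> vanishes_at_primitive_roots m q \<longrightarrow> degree p \<le> degree q)"

text \<open>
  The description is proper for every \<open>m > 0\<close>: the product of \<open>X - z\<close> over the primitive
  \<open>m\<close>-th roots of unity \<open>z\<close> has integer coefficients and divides, over the complex numbers,
  every polynomial that vanishes at all of them, so it is the only candidate.
\<close>

definition cyclotomic_poly :: "nat \<Rightarrow> int poly" where
  "cyclotomic_poly m = (THE p. is_cyclotomic_poly m p)"

definition binary :: "nat \<Rightarrow> bool" where
  "binary m \<longleftrightarrow>
     (\<exists>p q. prime p \<and> prime q \<and> odd p \<and> odd q \<and> p \<noteq> q \<and> m = p * q)"

definition theta :: "nat \<Rightarrow> nat" where
  "theta m = card {k. coeff (cyclotomic_poly m) k \<noteq> 0}"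

definition B :: "real \<Rightarrow> real \<Rightarrow> nat set" where
  "B \<epsilon> N =
     {m. binary m \<and> real m < N \<and> real (theta m) < real m powr (1/2 + \<epsilon>)}"

end

theory Submission
  imports Defs "HOL-Real_Asymp.Real_Asymp" "HOL-Number_Theory.Cong" "HOL-Analysis.Summation_Tests"
begin

text \<open>
  For distinct primes \<open>p\<close>, \<open>q\<close> write \<open>\<lambda>q + \<mu>p = pq + 1\<close> with \<open>0 < \<lambda> < p\<close> and \<open>0 < \<mu> < q\<close>. The explicit
  form of \<open>\<Phi>\<^sub>p\<^sub>q\<close> found by Lam and Leung shows that it has exactly \<open>2\<lambda>\<mu> - 1\<close> nonzero terms
  (\<open>theta_prime_mult\<close>). As \<open>\<lambda>/p + \<mu>/q\<close> is about \<open>1\<close>, one of the two fractions is at least about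
  \<open>1/2\<close>, so few terms mean that one of \<open>p\<close>, \<open>q\<close> has a small multiple that is congruent to \<open>1\<close> or
  \<open>-1\<close> modulo the other.

  Upper bounds. Let \<open>s < l\<close> be the two primes and \<open>N/2 \<le> sl < N\<close>. Sparseness gives a multiple \<open>kl\<close>,
  congruent to \<open>1\<close> or \<open>-1\<close> modulo \<open>s\<close>, with \<open>k \<le> 4s N powr (\<epsilon> - 1/2)\<close>. For given \<open>s\<close> and \<open>k\<close> this puts
  \<open>l < N/s\<close> into two residue classes modulo \<open>s\<close>, so at most \<open>2N/s\<^sup>2\<close> values of \<open>l\<close> are possible.
  Summing over \<open>k\<close> leaves \<open>8 N powr (1/2 + \<epsilon>) / s\<close>, and the sum of \<open>1/s\<close> over the primes \<open>s\<close> between two fixed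
  powers of \<open>N\<close> is bounded by Mertens' estimate. Adding up dyadic ranges proves
  the bound \<open>O(N powr (1/2 + \<epsilon>))\<close> for every \<open>\<epsilon> < 1/2\<close> (\<open>card_B_upper\<close>). It contains both upper
  bounds of the theorem, because the exponent is below \<open>1\<close> and a power of \<open>N\<close> outgrows \<open>(ln N)\<^sup>2\<close>.

  Lower bound. Sparse examples come from consecutive integers \<open>n\<close>, \<open>n + 1\<close> of size \<open>x = \<surd>N\<close> that
  have prime factors \<open>p\<close> and \<open>q\<close>, respectively, above \<open>x powr (1 - \<delta>)\<close>: then \<open>\<lambda>q = n + 1\<close>, and there are at
  most \<open>2\<lambda>q = O(x)\<close> nonzero terms, while \<open>pq\<close> lies between \<open>x powr (2 - 2\<delta>)\<close> and \<open>N\<close>. Such pairs are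
  forced by a pigeonhole argument. There are arbitrarily large finite sets \<open>A\<close> of positive integers in
  which the difference of any two elements divides both (\<open>exists_difference_divides_set\<close>). Let \<open>L\<close> be the
  product of \<open>A\<close>. For each \<open>a \<in> A\<close>, a proportion of at least \<open>\<delta>/4\<close> of the \<open>t \<le> x\<close> is such that
  \<open>(L/a)t + 1\<close> has a large prime factor, again by Mertens. If \<open>|A| > 8/\<delta>\<close>, then a positive
  proportion of the \<open>t\<close> is good for two elements \<open>a < b\<close>; and as \<open>a((L/a)t + 1) = Lt + a\<close>, dividing
  \<open>Lt + a\<close> and \<open>Lt + b\<close> by \<open>b - a\<close> yields consecutive integers. Since \<open>t\<close> can be recovered from
  \<open>a\<close>, \<open>b\<close>, \<open>p\<close>, \<open>q\<close> modulo \<open>pq > x\<close>, this gives \<open>\<Omega>(\<surd>N)\<close> different products (\<open>card_B_lower\<close>).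
\<close>

section \<open>Mertens' estimate\<close>

lemma prod_coprime_dvd:
  fixes f :: "'a \<Rightarrow> nat"
  assumes "finite A" "\<And>a. a \<in> A \<Longrightarrow> f a dvd n"
    and "\<And>a b. a \<in> A \<Longrightarrow> b \<in> A \<Longrightarrow> a \<noteq> b \<Longrightarrow> coprime (f a) (f b)"
  shows "prod f A dvd n"
  using assms
proof (induction A rule: finite_induct)
  case (insert a A)
  have "coprime (f a) (prod f A)"
    using insert by (intro prod_coprime_right) auto
  then show ?case using insert by (auto intro!: divides_mult)
qed auto

lemma binomial_odd_central_le: "(2 * m + 1) choose m \<le> 4 ^ m"
proof -
  have "2 * ((2 * m + 1) choose m) = ((2 * m + 1) choose m) + ((2 * m + 1) choose (m + 1))"
    using binomial_symmetric[of m "2 * m + 1"] by simp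
  also have "\<dots> = (\<Sum>k\<in>{m, m + 1}. (2 * m + 1) choose k)" by simp
  also have "\<dots> \<le> (\<Sum>k\<le>2 * m + 1. (2 * m + 1) choose k)"
    by (intro sum_mono2) auto
  also have "\<dots> = 2 ^ (2 * m + 1)" by (rule choose_row_sum)
  finally show ?thesis by (simp add: power_mult)
qed

text \<open>
  The primes in the upper half of \<open>{1..2m + 1}\<close> all divide the central binomial coefficient
  \<open>2m + 1\<close> over \<open>m\<close>, which is at most \<open>4 ^ m\<close>; the remaining primes are handled by induction.
\<close>
lemma primorial_le: "(\<Prod>p | prime p \<and> p \<le> n. p) \<le> (4::nat) ^ n"
proof (induction n rule: less_induct)
  case (less n)
  show ?case
  proof (cases "n \<le> 2")
    case True
    then consider "n = 0" | "n = 1" | "n = 2" by linarith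
    then show ?thesis
    proof cases
      case 3
      have "{p. prime p \<and> p \<le> n} = {2::nat}"
        using 3 by (auto dest: prime_ge_2_nat)
      then show ?thesis using 3 by simp
    next
      case 2
      have "{p. prime p \<and> p \<le> n} = {}" using 2 by (auto dest: prime_ge_2_nat)
      then show ?thesis by (simp only: prod.empty) simp
    next
      case 1
      have "{p. prime p \<and> p \<le> n} = {}" using 1 by (auto dest: prime_ge_2_nat)
      then show ?thesis by (simp only: prod.empty) simp
    qed
  next
    case big: False
    show ?thesis
    proof (cases "even n")
      case True
      then have "\<not> prime n" using big prime_odd_nat[of n] by auto
      then have "{p. prime p \<and> p \<le> n} = {p. prime p \<and> p \<le> n - 1}"
        using big le_eq_less_or_eq by auto
      then have "(\<Prod>p | prime p \<and> p \<le> n. p) \<le> 4 ^ (n - 1)" using less[of "n - 1"] big by simp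
      also have "\<dots> \<le> 4 ^ n" by (intro power_increasing) auto
      finally show ?thesis .
    next
      case False
      then obtain m where n: "n = 2 * m + 1" by (auto elim: oddE)
      have m: "m \<ge> 1" using big n by linarith
      have "(\<Prod>p | prime p \<and> p \<le> n. p) =
          (\<Prod>p | prime p \<and> p \<le> m + 1. p) * (\<Prod>p | prime p \<and> m + 1 < p \<and> p \<le> n. p)"
        using n by (subst prod.union_disjoint [symmetric]) (auto intro!: prod.cong)
      also have "\<dots> \<le> 4 ^ (m + 1) * 4 ^ m"
      proof (intro mult_mono)
        show "(\<Prod>p | prime p \<and> p \<le> m + 1. p) \<le> (4::nat) ^ (m + 1)"
          using less[of "m + 1"] n m by simp
        have "(\<Prod>p | prime p \<and> m + 1 < p \<and> p \<le> n. p) dvd (n choose m)"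
        proof (rule prod_coprime_dvd)
          fix p assume p: "p \<in> {p. prime p \<and> m + 1 < p \<and> p \<le> n}"
          have "fact m * fact (n - m) * (n choose m) = fact n"
            using n by (intro binomial_fact_lemma) auto
          then have "p dvd fact m * fact (n - m) * (n choose m)"
            using p by (simp add: prime_dvd_fact_iff)
          moreover have "\<not> p dvd fact m" "\<not> p dvd fact (n - m)"
            using p n by (simp_all add: prime_dvd_fact_iff del: fact_Suc)
          moreover have "prime p" using p by simp
          ultimately show "p dvd (n choose m)" by (simp only: prime_dvd_mult_iff) blast
        qed (auto intro: primes_coprime)
        then have "(\<Prod>p | prime p \<and> m + 1 < p \<and> p \<le> n. p) \<le> (n choose m)"
          using n by (intro dvd_imp_le) auto
        then show "(\<Prod>p | prime p \<and> m + 1 < p \<and> p \<le> n. p) \<le> 4 ^ m"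
          using binomial_odd_central_le[of m] n by simp
      qed auto
      also have "\<dots> = 4 ^ n" by (simp add: n mult_2 power_add)
      finally show ?thesis .
    qed
  qed
qed

definition mertens_sum :: "nat \<Rightarrow> real" where
  "mertens_sum n = (\<Sum>p | prime p \<and> p \<le> n. ln (real p) / real p)"

lemma ln_fact_le: "ln (fact n :: real) \<le> real n * ln (real n)"
proof (cases "n = 0")
  case False
  have "(fact n :: real) \<le> real n ^ n"
    using fact_le_power[of n, where 'a = real] by (simp)
  then have "ln (fact n :: real) \<le> ln (real n ^ n)"
    using False by (subst ln_le_cancel_iff) auto
  then show ?thesis using False by (simp add: ln_realpow)
qed auto

lemma ln_fact_ge: "ln (fact n :: real) \<ge> real n * ln (real n) - real n"
proof (cases "n = 0")
  case False
  have "real n ^ n / fact n \<le> exp (real n)"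
  proof -
    have "(\<Sum>k\<in>{n}. inverse (fact k) *\<^sub>R real n ^ k) \<le> (\<Sum>k. inverse (fact k) *\<^sub>R real n ^ k)"
      by (intro sum_le_suminf summable_exp_generic) auto
    then show ?thesis by (simp add: exp_def divide_inverse mult.commute)
  qed
  then have "ln (real n ^ n / fact n) \<le> ln (exp (real n))"
    using False by (subst ln_le_cancel_iff) auto
  then show ?thesis using False by (simp add: ln_div ln_realpow)
qed auto

lemma real_nat_div_ge: "real n / real d - 1 \<le> real (n div d)"
  by (metis floor_divide_of_nat_eq of_int_of_nat_eq real_of_int_floor_ge_diff_one)

text \<open>
  The powers \<open>p ^ (n div p)\<close> of the primes \<open>p \<le> n\<close> all divide \<open>fact n\<close>, so the sum of
  \<open>(n div p) ln p\<close> is at most \<open>ln (fact n) \<le> n ln n\<close>. Replacing \<open>n div p\<close> by \<open>n / p\<close> costs at most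
  the logarithm of the product of these primes.
\<close>
lemma mertens_upper: "mertens_sum n \<le> ln (real n) + ln 4"
proof (cases "n = 0")
  case True
  then show ?thesis by (auto simp: mertens_sum_def)
next
  case False
  define P where "P = {p. prime p \<and> p \<le> n}"
  have fin: "finite P" by (auto simp: P_def)
  have pos: "p > 0" if "p \<in> P" for p using that by (auto simp: P_def prime_gt_0_nat)
  have "(\<Prod>p\<in>P. p ^ (n div p)) dvd fact n"
  proof (rule prod_coprime_dvd[OF fin])
    fix p assume p: "p \<in> P"
    have "p ^ (n div p) dvd (\<Prod>k\<in>{1..n div p}. p * k)"
      by (simp add: prod.distrib)
    also have "(\<Prod>k\<in>{1..n div p}. p * k) = \<Prod>((\<lambda>k. p * k) ` {1..n div p})"
      using pos[OF p] by (subst prod.reindex) (auto simp: inj_on_def)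
    also have "\<dots> dvd \<Prod>{1..n}"
      using pos[OF p] 
      by (intro prod_dvd_prod_subset) (auto simp: less_eq_div_iff_mult_less_eq mult.commute)
    finally show "p ^ (n div p) dvd fact n" by (simp add: fact_prod)
  qed (auto simp: P_def intro!: primes_coprime coprime_power_left_iff[THEN iffD2])
  then have "(\<Prod>p\<in>P. p ^ (n div p)) \<le> fact n" by (intro dvd_imp_le) auto
  then have le: "real (\<Prod>p\<in>P. p ^ (n div p)) \<le> fact n"
    by (metis of_nat_fact of_nat_le_iff)
  have "(\<Sum>p\<in>P. real (n div p) * ln (real p)) = ln (real (\<Prod>p\<in>P. p ^ (n div p)))"
    using pos by (simp add: ln_prod fin ln_realpow)
  also have "\<dots> \<le> ln (fact n)"
    using le pos by (subst ln_le_cancel_iff) (auto intro!: prod_pos)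
  also have "\<dots> \<le> real n * ln (real n)" by (rule ln_fact_le)
  finally have 1: "(\<Sum>p\<in>P. real (n div p) * ln (real p)) \<le> real n * ln (real n)" .
  have 2: "(\<Sum>p\<in>P. ln (real p)) \<le> real n * ln 4"
  proof -
    have "(\<Sum>p\<in>P. ln (real p)) = ln (real (\<Prod>p\<in>P. p))"
      using pos by (simp add: ln_prod fin)
    also have "\<dots> \<le> ln (real (4 ^ n))"
      using primorial_le[of n] pos unfolding P_def [symmetric]
      by (subst ln_le_cancel_iff) (auto intro!: prod_pos simp del: of_nat_power of_nat_prod)
    also have "\<dots> = real n * ln 4" by (simp add: ln_realpow)
    finally show ?thesis .
  qed
  have "real n * mertens_sum n = (\<Sum>p\<in>P. (real n / real p) * ln (real p))"
    by (simp add: mertens_sum_def P_def sum_distrib_left mult_ac)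
  also have "\<dots> \<le> (\<Sum>p\<in>P. real (n div p) * ln (real p) + ln (real p))"
  proof (intro sum_mono)
    fix p assume p: "p \<in> P"
    have "real n / real p \<le> real (n div p) + 1"
      using real_nat_div_ge[of n p] by simp
    moreover have "ln (real p) \<ge> 0" using pos[OF p] by auto
    ultimately have "(real n / real p) * ln (real p) \<le> (real (n div p) + 1) * ln (real p)"
      by (intro mult_right_mono)
    then show "(real n / real p) * ln (real p) \<le> real (n div p) * ln (real p) + ln (real p)"
      by (simp add: algebra_simps)
  qed
  also have "\<dots> \<le> real n * (ln (real n) + ln 4)"
    using 1 2 by (simp add: sum.distrib algebra_simps)
  finally show ?thesis using False by simp
qed

lemma card_multiples_le:
  assumes "d > 0"
  shows "card {k \<in> {1..n}. d dvd k} \<le> n div d"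
proof -
  have "card {k \<in> {1..n}. d dvd k} \<le> card {1..n div d}"
  proof (rule card_inj_on_le[of "\<lambda>k. k div d"])
    show "inj_on (\<lambda>k. k div d) {k \<in> {1..n}. d dvd k}"
      by (auto simp: inj_on_def dvd_def)
    show "(\<lambda>k. k div d) ` {k \<in> {1..n}. d dvd k} \<subseteq> {1..n div d}"
    proof safe
      fix k assume k: "k \<in> {1..n}" "d dvd k"
      then have "d \<le> k" by (intro dvd_imp_le) auto
      then show "k div d \<in> {1..n div d}"
        using k assms div_le_mono[of k n d] div_greater_zero_iff[of k d] by simp
    qed
  qed auto
  then show ?thesis by simp
qed

lemma geometric_tail_le:
  fixes p :: nat
  assumes p2: "p \<ge> 2"
  shows "(\<Sum>j\<in>{1..n}. (1 / real p) ^ j) \<le> 1 / (real p - 1)"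
proof -
  have "(\<Sum>j\<in>{1..n}. (1 / real p) ^ j) = (1 - (1 / real p) ^ n) / (real p - 1)"
  proof (induction n)
    case (Suc n)
    have "(1 - (1 / real p) ^ n) / (real p - 1) + (1 / real p) ^ Suc n
        = (1 - (1 / real p) ^ Suc n) / (real p - 1)"
      using p2 by (simp add: field_simps)
    then show ?case using Suc by simp
  qed auto
  also have "\<dots> \<le> 1 / (real p - 1)"
    by (rule divide_right_mono) (use p2 in auto)
  finally show ?thesis .
qed

text \<open>
  Legendre's formula: the multiplicity of \<open>p\<close> in \<open>k\<close> is the number of powers \<open>p ^ j\<close>, \<open>j \<ge> 1\<close>, that divide
  \<open>k\<close>. Interchanging the two counts leads to a geometric series.
\<close>
lemma multiplicity_fact_le:
  assumes p: "prime p"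
  shows "real (multiplicity p (fact n :: nat)) \<le> real n / (real p - 1)"
proof -
  have p2: "p \<ge> 2" using p by (rule prime_ge_2_nat)
  have m: "multiplicity p k = card {j \<in> {1..n}. p ^ j dvd k}" if "k \<in> {1..n}" for k
  proof -
    have "\<not> p ^ k dvd k"
    proof
      assume "p ^ k dvd k"
      then have "p ^ k \<le> k" using that by (intro dvd_imp_le) auto
      moreover have "k < 2 ^ k" by (rule less_exp)
      moreover have "2 ^ k \<le> p ^ k" using p2 by (intro power_mono) auto
      ultimately show False by linarith
    qed
    then have "multiplicity p k < k"
      using that p2 by (intro multiplicity_lessI) auto
    then have le: "multiplicity p k \<le> n" using that by simp
    have iff: "p ^ j dvd k \<longleftrightarrow> j \<le> multiplicity p k" for j
      using that p2 by (intro power_dvd_iff_le_multiplicity) auto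
    have "{j \<in> {1..n}. p ^ j dvd k} = {1..multiplicity p k}"
      unfolding iff using le by (intro set_eqI) (simp, linarith)
    then show ?thesis by simp
  qed
  have "multiplicity p (fact n :: nat) = (\<Sum>k\<in>{1..n}. multiplicity p k)"
  proof -
    have "multiplicity p (\<Prod>k\<in>{1..n}. k) = (\<Sum>k\<in>{1..n}. multiplicity p k)"
      by (rule prime_elem_multiplicity_prod_distrib) (use prime_imp_prime_elem[OF p] in simp_all)
    then show ?thesis by (simp only: fact_prod of_nat_id)
  qed
  also have "\<dots> = (\<Sum>k\<in>{1..n}. \<Sum>j\<in>{1..n}. if p ^ j dvd k then 1 else 0)"
  proof (intro sum.cong refl)
    fix k assume "k \<in> {1..n}"
    then show "multiplicity p k = (\<Sum>j\<in>{1..n}. if p ^ j dvd k then 1 else 0)"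
      by (simp only: m card_eq_sum sum.inter_filter finite_atLeastAtMost)
  qed
  also have "\<dots> = (\<Sum>j\<in>{1..n}. \<Sum>k\<in>{1..n}. if p ^ j dvd k then 1 else 0)"
    by (rule sum.swap)
  also have "\<dots> = (\<Sum>j\<in>{1..n}. card {k \<in> {1..n}. p ^ j dvd k})"
    by (simp only: card_eq_sum sum.inter_filter finite_atLeastAtMost)
  also have "\<dots> \<le> (\<Sum>j\<in>{1..n}. n div p ^ j)"
    using p2 by (intro sum_mono card_multiples_le) auto
  finally have "real (multiplicity p (fact n :: nat)) \<le> real (\<Sum>j\<in>{1..n}. n div p ^ j)"
    by (simp only: of_nat_le_iff)
  also have "\<dots> \<le> (\<Sum>j\<in>{1..n}. real n * (1 / real p) ^ j)"
    unfolding of_nat_sum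
  proof (intro sum_mono)
    fix j show "real (n div p ^ j) \<le> real n * (1 / real p) ^ j"
      using of_nat_div_le_of_nat[where 'a = real, of n "p ^ j"] by (simp add: power_divide)
  qed
  also have "\<dots> = real n * (\<Sum>j\<in>{1..n}. (1 / real p) ^ j)" by (simp add: sum_distrib_left)
  also have "\<dots> \<le> real n * (1 / (real p - 1))"
  proof (intro mult_left_mono)
    show "(\<Sum>j\<in>{1..n}. (1 / real p) ^ j) \<le> 1 / (real p - 1)"
      by (rule geometric_tail_le[OF p2])
    show "0 \<le> real n" by simp
  qed
  finally show ?thesis by simp
qed

text \<open>
  By Legendre's formula, \<open>ln (fact n)\<close> is at most the sum of \<open>n ln p / (p - 1)\<close> over the primes \<open>p \<le> n\<close>.
  This differs from \<open>n\<close> times the Mertens sum by \<open>n\<close> times a partial sum of a convergent series.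
\<close>
lemma mertens_lower: "\<exists>C. \<forall>n\<ge>1. mertens_sum n \<ge> ln (real n) - C"
proof -
  define g where "g = (\<lambda>k::nat. ln (real k) / (real k * (real k - 1)))"
  have summ: "summable g"
  proof (rule summable_comparison_test_bigo)
    show "summable (\<lambda>n. norm (real n powr (-3/2)))" by (simp add: summable_real_powr_iff)
    show "g \<in> O(\<lambda>n. real n powr (-3/2))" unfolding g_def by real_asymp
  qed
  have g0: "g k \<ge> 0" for k
    by (cases "k = 0"; cases "k = 1") (auto simp: g_def)
  have "mertens_sum n \<ge> ln (real n) - (1 + suminf g)" if n: "n \<ge> 1" for n
  proof -
    define P where "P = {p. prime p \<and> p \<le> n}"
    have fin: "finite P" by (auto simp: P_def)
    have p2: "p \<ge> 2" if "p \<in> P" for p using that by (auto simp: P_def prime_ge_2_nat)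
    have pf: "prime_factors (fact n :: nat) = P"
      by (auto simp: P_def prime_factors_dvd prime_dvd_fact_iff)
    have "(fact n :: nat) = (\<Prod>p\<in>P. p ^ multiplicity p (fact n))"
      using prod_prime_factors[of "fact n :: nat"] pf by simp
    then have "ln (real (fact n)) = ln (real (\<Prod>p\<in>P. p ^ multiplicity p (fact n)))" by simp
    also have "\<dots> = (\<Sum>p\<in>P. real (multiplicity p (fact n :: nat)) * ln (real p))"
    proof -
      have pos: "0 < p" if "p \<in> P" for p using p2[OF that] by simp
      then show ?thesis by (simp add: ln_prod fin ln_realpow)
    qed
    also have "\<dots> \<le> (\<Sum>p\<in>P. real n / (real p - 1) * ln (real p))"
    proof (intro sum_mono mult_right_mono multiplicity_fact_le)
      fix p assume p: "p \<in> P"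
      show "prime p" using p by (simp add: P_def)
      show "0 \<le> ln (real p)" using p2[OF p] by simp
    qed
    also have "\<dots> = (\<Sum>p\<in>P. real n * (ln (real p) / real p) + real n * g p)"
    proof (intro sum.cong refl)
      fix p assume "p \<in> P"
      from p2[OF this] have "real p > 1" by simp
      then show "real n / (real p - 1) * ln (real p) = real n * (ln (real p) / real p) + real n * g p"
        by (simp add: g_def field_simps)
    qed
    also have "\<dots> = real n * mertens_sum n + real n * sum g P"
      by (simp add: sum.distrib sum_distrib_left mertens_sum_def P_def)
    also have "\<dots> \<le> real n * mertens_sum n + real n * suminf g"
      using sum_le_suminf[OF summ fin] g0 by (simp add: mult_left_mono)
    finally have "real n * ln (real n) - real n \<le> real n * mertens_sum n + real n * suminf g"
      using ln_fact_ge[of n] by simp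
    then have "real n * ln (real n) \<le> real n * (mertens_sum n + suminf g + 1)"
      by (simp add: algebra_simps)
    then have "ln (real n) \<le> mertens_sum n + suminf g + 1" using n by simp
    then show ?thesis by simp
  qed
  then show ?thesis by blast
qed

section \<open>The number of terms of a binary cyclotomic polynomial\<close>

text \<open>
  Reading the equation modulo \<open>q\<close> determines \<open>i\<close>, and modulo \<open>p\<close> it determines \<open>j\<close>. For this reason no two terms of
  the explicit cyclotomic polynomial can cancel.
\<close>
lemma crt_exponents_eq:
  fixes p q :: nat
  assumes "coprime p q" "i < q" "i' < q" "j < p" "j' < p"
    and eq: "i * p + j * q = i' * p + j' * q + c * (p * q)"
  shows "i = i' \<and> j = j'"
proof
  have "(i * p) mod q = (i * p + j * q) mod q" by simp
  also have "\<dots> = (i' * p + (j' + c * p) * q) mod q"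
    by (subst eq) (simp add: algebra_simps)
  also have "\<dots> = (i' * p) mod q" by simp
  finally have "[i * p = i' * p] (mod q)" by (simp add: cong_def)
  then have "[i = i'] (mod q)" using assms(1) by (simp add: cong_mult_rcancel_nat)
  then show "i = i'" using assms by (simp add: cong_less_modulus_unique_nat)
  have "(j * q) mod p = (i * p + j * q) mod p" by simp
  also have "\<dots> = ((i' + c * q) * p + j' * q) mod p"
    by (subst eq) (simp add: algebra_simps)
  also have "\<dots> = (j' * q) mod p" by simp
  finally have "[j * q = j' * q] (mod p)" by (simp add: cong_def)
  then have "[j = j'] (mod p)"
    using assms(1) by (simp add: cong_mult_rcancel_nat coprime_commute)
  then show "j = j'" using assms by (simp add: cong_less_modulus_unique_nat)
qed

lemma map_poly_of_int_diff:
  "map_poly of_int (F - G) = (map_poly of_int F - map_poly of_int G :: complex poly)"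
  by (intro poly_eqI) (simp add: coeff_map_poly)

lemma map_poly_of_int_monom_sum:
  "map_poly of_int (\<Sum>n\<in>S. monom 1 n) = (\<Sum>n\<in>S. monom 1 n :: complex poly)"
  by (intro poly_eqI) (simp add: coeff_map_poly coeff_sum if_distrib cong: if_cong)

lemma coeff_monom_sum:
  assumes "finite S"
  shows "coeff (\<Sum>n\<in>S. monom 1 n :: int poly) k = (if k \<in> S then 1 else 0)"
  using assms by (simp add: coeff_sum)

text \<open>
  The order of a root of \<open>z ^ (p * q) = 1\<close> that is not primitive divides \<open>p\<close> or \<open>q\<close>, and
  \<open>z = 1\<close> occurs in both cases; inclusion and exclusion leaves at least \<open>pq - (p + q - 1)\<close> primitive roots.
\<close>
lemma card_primitive_roots_ge:
  assumes p: "prime p" and q: "prime q"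
  shows "(p - 1) * (q - 1) \<le> card {z. primitive_root_of_unity (p * q) z}"
proof -
  define U where "U = (\<lambda>n. {z :: complex. z ^ n = 1})"
  have pos: "p > 0" "q > 0" using p q by (simp_all add: prime_gt_0_nat)
  have cardU: "card (U n) = n" "finite (U n)" if "n > 0" for n
    using that card_roots_unity_eq[of n] finite_roots_unity[of n] by (simp_all add: U_def)
  have sub: "{z. primitive_root_of_unity (p * q) z} \<subseteq> U (p * q)"
    by (auto simp: primitive_root_of_unity_def U_def)
  then have fin: "finite {z. primitive_root_of_unity (p * q) z}"
    using cardU[of "p * q"] pos by (auto intro: finite_subset)
  have cover: "U (p * q) \<subseteq> {z. primitive_root_of_unity (p * q) z} \<union> (U p \<union> U q)"
  proof
    fix z assume z: "z \<in> U (p * q)"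
    show "z \<in> {z. primitive_root_of_unity (p * q) z} \<union> (U p \<union> U q)"
    proof (cases "primitive_root_of_unity (p * q) z")
      case False
      then obtain k where k: "0 < k" "k < p * q" "z ^ k = 1"
        using z pos by (auto simp: primitive_root_of_unity_def U_def)
      define g where "g = gcd k (p * q)"
      obtain x y where xy: "k * x = p * q * y + g"
        using bezout_nat[of k "p * q"] k unfolding g_def by auto
      have "1 = z ^ (k * x)" using k by (simp add: power_mult)
      also have "\<dots> = z ^ g" using z by (simp add: xy power_add power_mult U_def)
      finally have zg: "z ^ g = 1" by simp
      have gdvd: "g dvd p * q" by (simp add: g_def)
      have "g \<le> k" using k by (simp add: g_def gcd_le1_nat)
      then have "g \<noteq> p * q" using k by simp
      obtain d where d: "p * q = g * d" using gdvd by (auto elim: dvdE)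
      have "d \<noteq> 1" using d \<open>g \<noteq> p * q\<close> by auto
      then obtain r where r: "prime r" "r dvd d" using prime_factor_nat by blast
      have "r dvd p * q" using r d by simp
      then have "r = p \<or> r = q"
        using r p q by (metis prime_dvd_mult_iff primes_dvd_imp_eq)
      then have "g dvd p \<or> g dvd q"
      proof
        assume "r = p"
        then obtain e where "d = p * e" using r by (auto elim: dvdE)
        then have "q = g * e" using d pos by simp
        then show ?thesis by simp
      next
        assume "r = q"
        then obtain e where "d = q * e" using r by (auto elim: dvdE)
        then have "p = g * e" using d pos by simp
        then show ?thesis by simp
      qed
      then have "z ^ p = 1 \<or> z ^ q = 1"
        using zg by (metis dvdE power_mult power_one)
      then show ?thesis by (auto simp: U_def)
    qed auto
  qed
  have "card (U p \<union> U q) + 1 \<le> p + q"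
  proof -
    have "1 \<in> U p \<inter> U q" by (simp add: U_def)
    then have "card (U p \<inter> U q) > 0" using cardU pos by (auto simp: card_gt_0_iff)
    then show ?thesis using card_Un_Int[of "U p" "U q"] cardU pos by simp
  qed
  moreover have "p * q \<le> card {z. primitive_root_of_unity (p * q) z} + card (U p \<union> U q)"
    using card_mono[OF _ cover] card_Un_le[of "{z. primitive_root_of_unity (p * q) z}" "U p \<union> U q"]
      fin cardU pos by (simp add: order.trans)
  moreover have "(p - 1) * (q - 1) + p + q = p * q + 1"
    using pos by (cases p; cases q) auto
  ultimately show "(p - 1) * (q - 1) \<le> card {z. primitive_root_of_unity (p * q) z}" by linarith
qed

lemma degree_ge_of_vanishing:
  assumes "prime p" "prime q" "vanishes_at_primitive_roots (p * q) G" "G \<noteq> 0"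
  shows "(p - 1) * (q - 1) \<le> degree G"
proof -
  let ?G = "map_poly of_int G :: complex poly"
  have ne: "?G \<noteq> 0"
  proof
    assume "?G = 0"
    then have "coeff ?G (degree G) = 0" by simp
    then show False using assms(4) by (simp add: coeff_map_poly)
  qed
  have "card {z. primitive_root_of_unity (p * q) z} \<le> card {z. poly ?G z = 0}"
    using assms(3) poly_roots_finite[OF ne]
    by (intro card_mono) (auto simp: vanishes_at_primitive_roots_def)
  also have "\<dots> \<le> degree ?G" using ne by (rule card_poly_roots_bound)
  also have "\<dots> \<le> degree G" by (intro degree_le) (simp add: coeff_map_poly coeff_eq_0)
  finally show ?thesis using card_primitive_roots_ge[OF assms(1,2)] by linarith
qed

text \<open>
  By the count of the primitive roots, \<open>F\<close> has the least possible degree. The difference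
  of two monic candidates would vanish at the same points with a smaller degree.
\<close>
lemma cyclotomic_poly_eqI:
  assumes "prime p" "prime q" "vanishes_at_primitive_roots (p * q) F" "lead_coeff F = 1"
    and deg: "degree F = (p - 1) * (q - 1)"
  shows "cyclotomic_poly (p * q) = F"
  unfolding cyclotomic_poly_def
proof (rule the_equality)
  have min: "(p - 1) * (q - 1) \<le> degree G"
    if "lead_coeff G = 1" "vanishes_at_primitive_roots (p * q) G" for G
    using degree_ge_of_vanishing[OF assms(1,2) that(2)] that(1) by fastforce
  show F: "is_cyclotomic_poly (p * q) F"
    using assms min by (simp add: is_cyclotomic_poly_def)
  fix G assume G: "is_cyclotomic_poly (p * q) G"
  have degG: "degree G = degree F"
    using F G by (simp add: is_cyclotomic_poly_def le_antisym)
  have van: "vanishes_at_primitive_roots (p * q) (F - G)"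
    using F G unfolding is_cyclotomic_poly_def vanishes_at_primitive_roots_def
    by (simp add: map_poly_of_int_diff)
  show "G = F"
  proof (rule ccontr)
    assume "G \<noteq> F"
    then have ne: "F - G \<noteq> 0" by simp
    have "coeff (F - G) (degree F) = 0"
      using assms(4) G degG by (simp add: is_cyclotomic_poly_def)
    moreover have "degree (F - G) \<le> degree F" using degG by (simp add: degree_diff_le)
    moreover have "degree (F - G) \<ge> degree F"
      using degree_ge_of_vanishing[OF assms(1,2) van ne] deg by simp
    ultimately have "lead_coeff (F - G) = 0" by (metis le_antisym)
    then show False using ne leading_coeff_0_iff by blast
  qed
qed

text \<open>
  The polynomial of Lam and Leung: with \<open>\<lambda> = la\<close> and \<open>\<mu> = mu\<close>, it is the product of
  \<open>\<Sum>i<\<mu>. x ^ (i * p)\<close> and \<open>\<Sum>j<\<lambda>. x ^ (j * q)\<close> minus \<open>1 / x ^ (p * q)\<close> times the product of the complementary sums over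
  \<open>\<mu> \<le> i < q\<close> and \<open>\<lambda> \<le> j < p\<close>. At a primitive root \<open>z\<close> the full sums over \<open>i < q\<close> and over \<open>j < p\<close> vanish,
  so both complementary factors are the negatives of the first ones and the products agree. The
  \<open>\<lambda>\<mu>\<close> positive and \<open>(p - \<lambda>)(q - \<mu>) = \<lambda>\<mu> - 1\<close> negative terms have different exponents.
\<close>
lemma theta_prime_mult:
  fixes p q la mu :: nat
  assumes p: "prime p" and q: "prime q" and "p \<noteq> q"
    and la: "0 < la" "la < p" and mu: "0 < mu" "mu < q"
    and bez: "la * q + mu * p = p * q + 1"
  shows "theta (p * q) + 1 = 2 * la * mu"
proof -
  have pos: "p > 1" "q > 1" using p q prime_gt_1_nat by blast+
  have cop: "coprime p q" using p q \<open>p \<noteq> q\<close> by (rule primes_coprime)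
  define I1 I2 where "I1 = {..<mu} \<times> {..<la}" and "I2 = {mu..<q} \<times> {la..<p}"
  define e where "e = (\<lambda>(i, j). i * p + j * q)"
  define e2 where "e2 = (\<lambda>x. e x - p * q)"
  define S1 S2 where "S1 = e ` I1" and "S2 = e2 ` I2"
  have fin: "finite S1" "finite S2" by (simp_all add: S1_def S2_def I1_def I2_def)
  have big: "e x \<ge> p * q + 1" if "x \<in> I2" for x
  proof -
    obtain i j where x: "x = (i, j)" "mu \<le> i" "la \<le> j"
      using \<open>x \<in> I2\<close> by (cases x) (simp add: I2_def)
    have "mu * p + la * q \<le> i * p + j * q" using x by (intro add_mono mult_right_mono) auto
    then show ?thesis using bez x by (simp add: e_def)
  qed
  have inj1: "inj_on e I1"
  proof (rule inj_onI)
    fix x y assume "x \<in> I1" "y \<in> I1" "e x = e y"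
    then show "x = y"
      using crt_exponents_eq[OF cop, of "fst x" "fst y" "snd x" "snd y" 0] la mu
      by (auto simp: I1_def e_def)
  qed
  have inj2: "inj_on e2 I2"
  proof (rule inj_onI)
    fix x y assume xy: "x \<in> I2" "y \<in> I2" "e2 x = e2 y"
    then have "e x = e y" using big[of x] big[of y] by (simp add: e2_def)
    then show "x = y"
      using crt_exponents_eq[OF cop, of "fst x" "fst y" "snd x" "snd y" 0] xy
      by (auto simp: I2_def e_def)
  qed
  have disj: "S1 \<inter> S2 = {}"
  proof (rule ccontr)
    assume "S1 \<inter> S2 \<noteq> {}"
    then obtain x y where xy: "x \<in> I1" "y \<in> I2" "e x = e2 y"
      by (auto simp: S1_def S2_def)
    then have "e y = e x + 1 * (p * q)" using big[of y] by (simp add: e2_def)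
    then have "fst y = fst x \<and> snd y = snd x"
      using xy la mu by (intro crt_exponents_eq[OF cop, of _ _ _ _ 1]) (auto simp: I1_def I2_def e_def)
    then show False using xy by (auto simp: I1_def I2_def)
  qed
  define F :: "int poly" where "F = (\<Sum>n\<in>S1. monom 1 n) - (\<Sum>n\<in>S2. monom 1 n)"
  have coeffF: "coeff F k = (if k \<in> S1 then 1 else 0) - (if k \<in> S2 then 1 else 0)" for k
    by (simp add: F_def coeff_monom_sum fin)
  define D where "D = (p - 1) * (q - 1)"
  have Deq: "D + p + q = p * q + 1" using pos by (cases p; cases q) (auto simp: D_def)
  have S1_le: "n \<le> D" if "n \<in> S1" for n
  proof -
    obtain i j where ij: "n = i * p + j * q" "i < mu" "j < la"
      using \<open>n \<in> S1\<close> by (auto simp: S1_def I1_def e_def)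
    have "(i + 1) * p + (j + 1) * q \<le> mu * p + la * q"
      using ij by (intro add_mono mult_right_mono) auto
    then show ?thesis using ij bez Deq by (simp add: algebra_simps)
  qed
  have S2_less: "n < D" if "n \<in> S2" for n
  proof -
    obtain i j where ij: "n = i * p + j * q - p * q" "i < q" "j < p" "(i, j) \<in> I2"
      using \<open>n \<in> S2\<close> by (auto simp: S2_def I2_def e2_def e_def)
    have "(i + 1) * p + (j + 1) * q \<le> q * p + p * q"
      using ij by (intro add_mono mult_right_mono) auto
    then show ?thesis using ij(1) big[OF ij(4)] Deq by (simp add: e_def algebra_simps)
  qed
  have D_in: "D \<in> S1"
  proof -
    have "e (mu - 1, la - 1) = D"
      using la mu bez Deq by (cases mu; cases la) (auto simp: e_def algebra_simps)
    then show ?thesis using la mu by (force simp: S1_def I1_def)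
  qed
  have D_coeff: "coeff F D = 1" using D_in disj by (auto simp: coeffF)
  have degF: "degree F = D"
  proof (rule antisym)
    show "degree F \<le> D"
    proof (rule degree_le, intro allI impI)
      fix k assume "D < k"
      then have "k \<notin> S1" "k \<notin> S2" using S1_le S2_less by (meson leD less_asym)+
      then show "coeff F k = 0" by (simp add: coeffF)
    qed
    show "D \<le> degree F" using D_coeff by (intro le_degree) simp
  qed
  have van: "vanishes_at_primitive_roots (p * q) F"
    unfolding vanishes_at_primitive_roots_def
  proof (intro allI impI)
    fix z assume z: "primitive_root_of_unity (p * q) z"
    have zpq: "z ^ (p * q) = 1" using z by (simp add: primitive_root_of_unity_def)
    define u v where "u = z ^ p" and "v = z ^ q"
    have "u \<noteq> 1" "v \<noteq> 1"
      using z pos by (simp_all add: primitive_root_of_unity_def u_def v_def)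
    moreover have "u ^ q = 1" "v ^ p = 1"
      using zpq by (simp_all add: u_def v_def power_mult [symmetric] mult.commute)
    ultimately have sums: "(\<Sum>i<q. u ^ i) = 0" "(\<Sum>j<p. v ^ j) = 0"
      by (simp_all add: geometric_sum)
    define A A' where "A = (\<Sum>i<mu. u ^ i)" and "A' = (\<Sum>i\<in>{mu..<q}. u ^ i)"
    define B B' where "B = (\<Sum>j<la. v ^ j)" and "B' = (\<Sum>j\<in>{la..<p}. v ^ j)"
    have "{..<q} = {..<mu} \<union> {mu..<q}" "{..<p} = {..<la} \<union> {la..<p}" using la mu by auto
    then have "(\<Sum>i<q. u ^ i) = A + A'" "(\<Sum>j<p. v ^ j) = B + B'"
      by (simp_all add: A_def A'_def B_def B'_def sum.union_disjoint ivl_disj_int)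
    then have "A' = - A" "B' = - B" using sums by (simp_all add: add_eq_0_iff)
    have ze: "z ^ e x = u ^ fst x * v ^ snd x" for x
      by (simp add: e_def u_def v_def power_add power_mult [symmetric] mult.commute split: prod.split)
    have ze2: "z ^ e2 x = z ^ e x" if "x \<in> I2" for x
    proof -
      have "z ^ e x = z ^ (e2 x + p * q)" using big[OF that] by (simp add: e2_def)
      then show ?thesis using zpq by (simp add: power_add)
    qed
    have "poly (map_poly of_int F) z = (\<Sum>n\<in>S1. z ^ n) - (\<Sum>n\<in>S2. z ^ n)"
      by (simp add: F_def map_poly_of_int_diff map_poly_of_int_monom_sum poly_sum poly_monom)
    also have "(\<Sum>n\<in>S1. z ^ n) = (\<Sum>x\<in>I1. u ^ fst x * v ^ snd x)"
      by (simp add: S1_def sum.reindex[OF inj1] ze)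
    also have "\<dots> = A * B"
      by (simp add: I1_def A_def B_def sum_product sum.cartesian_product case_prod_unfold)
    also have "(\<Sum>n\<in>S2. z ^ n) = (\<Sum>x\<in>I2. u ^ fst x * v ^ snd x)"
      by (simp add: S2_def sum.reindex[OF inj2] ze2 ze)
    also have "\<dots> = A' * B'"
      by (simp add: I2_def A'_def B'_def sum_product sum.cartesian_product case_prod_unfold)
    finally show "poly (map_poly of_int F) z = 0"
      using \<open>A' = - A\<close> \<open>B' = - B\<close> by simp
  qed
  have "cyclotomic_poly (p * q) = F"
    using p q van degF D_coeff by (intro cyclotomic_poly_eqI) (simp_all add: D_def)
  then have "theta (p * q) = card {k. coeff F k \<noteq> 0}" by (simp add: theta_def)
  also have "{k. coeff F k \<noteq> 0} = S1 \<union> S2" using disj by (auto simp: coeffF)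
  also have "card \<dots> = card S1 + card S2" by (intro card_Un_disjoint fin disj)
  also have "\<dots> = mu * la + (q - mu) * (p - la)"
    by (simp add: S1_def S2_def card_image inj1 inj2) (simp add: I1_def I2_def)
  finally have th: "theta (p * q) = mu * la + (q - mu) * (p - la)" .
  obtain r s where "q = mu + r" "p = la + s"
    using la mu by (metis less_imp_add_positive)
  then show ?thesis using th bez by (simp add: algebra_simps)
qed

lemma bezout_primes:
  assumes p: "prime p" and q: "prime q" and "p \<noteq> (q :: nat)"
  obtains la mu where "0 < la" "la < p" "0 < mu" "mu < q" "la * q + mu * p = p * q + 1"
proof -
  have pos: "p > 1" "q > 1" using p q prime_gt_1_nat by blast+
  have "coprime q p" using p q \<open>p \<noteq> q\<close> by (simp add: primes_coprime)
  then obtain x where "[q * x = 1] (mod p)" using cong_solve_coprime_nat by auto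
  then have la1: "((x mod p) * q) mod p = 1"
    using pos by (simp add: cong_def mult.commute mod_mult_right_eq)
  define la a where "la = x mod p" and "a = la * q div p"
  have lap: "la < p" using pos by (simp add: la_def)
  have eq: "la * q = a * p + 1"
    using div_mult_mod_eq[of "la * q" p] la1 by (simp add: la_def a_def)
  have la0: "0 < la" using eq by (cases la) auto
  have "la * q < p * q" using lap pos by simp
  then have "a * p < q * p" unfolding eq mult.commute[of q] by linarith
  then have aq: "a < q" using mult_less_cancel2 by blast
  have a0: "a > 0"
  proof (rule ccontr)
    assume "\<not> a > 0"
    then have "la * q = 1" using eq by simp
    then show False using pos by simp
  qed
  show ?thesis
  proof (rule that[of la "q - a"])
    show "la * q + (q - a) * p = p * q + 1"
      using eq aq less_imp_add_positive[OF aq] by (auto simp: algebra_simps)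
  qed (use la0 lap aq a0 in auto)
qed

section \<open>The upper bounds\<close>

text \<open>
  Let \<open>al + bs = sl + 1\<close>, so that there are \<open>2ab - 1\<close> nonzero terms. If \<open>2b \<ge> l\<close>, then \<open>al \<le> 2ab\<close>, and \<open>al\<close> is
  congruent to \<open>1\<close> modulo \<open>s\<close>. Otherwise \<open>2a \<ge> s\<close>, and \<open>(s - a)l = bs - 1\<close> is below \<open>2ab\<close> and
  congruent to \<open>-1\<close>.
\<close>
lemma small_multiple_of_theta:
  assumes s: "prime s" and l: "prime l" and "s \<noteq> (l :: nat)"
  obtains k where "k \<ge> 1" "k * l \<le> theta (s * l) + 1" "(k * l) mod s = 1 \<or> (k * l) mod s = s - 1"
proof -
  have s1: "s > 1" using s by (rule prime_gt_1_nat)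
  obtain a b where ab: "0 < a" "a < s" "0 < b" "b < l" and bez: "a * l + b * s = s * l + 1"
    using bezout_primes[OF assms] by blast
  have th: "theta (s * l) + 1 = 2 * a * b"
    using theta_prime_mult[OF assms ab bez] .
  obtain c where c: "l = b + c" "c > 0" using less_imp_add_positive[OF ab(4)] by auto
  obtain d where d: "s = a + d" "d > 0" using less_imp_add_positive[OF ab(2)] by auto
  show ?thesis
  proof (cases "l \<le> 2 * b")
    case True
    have "a * l = 1 + c * s" using bez c by (simp add: algebra_simps)
    then have "(a * l) mod s = 1" using s1 by (simp add: mod_Suc)
    moreover have "a * l \<le> a * (2 * b)" using True by (rule mult_left_mono) simp
    ultimately show ?thesis using that[of a] ab th by (simp add: mult_ac)
  next
    case False
    have eq: "b * s = d * l + 1"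
    proof -
      have "a * l + b * s = a * l + (d * l + 1)" using bez d by (simp add: algebra_simps)
      then show ?thesis by linarith
    qed
    have "s \<le> 2 * a"
    proof (rule ccontr)
      assume "\<not> s \<le> 2 * a"
      then have "a < d" using d by simp
      have "b * s < c * s" using False c s1 by simp
      moreover have "a * l \<le> d * l" using \<open>a < d\<close> by simp
      moreover have "a * l = 1 + c * s" using bez c by (simp add: algebra_simps)
      ultimately show False using eq by linarith
    qed
    then have "b * s \<le> b * (2 * a)" by (rule mult_left_mono) simp
    then have le: "d * l \<le> theta (s * l) + 1" using th eq by (simp add: mult_ac)
    have "b > 0" using ab by simp
    then have dl: "d * l = (s - 1) + (b - 1) * s" using eq s1 by (cases b) simp_all
    have "(d * l) mod s = s - 1" unfolding dl mod_mult_self1 using s1 by (intro mod_less) simp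
    then show ?thesis using that[of d] d le by simp
  qed
qed

text \<open>
  Multiplication by \<open>k\<close> is injective modulo \<open>s\<close> (otherwise \<open>r\<close> would be \<open>0\<close>), so each block of
  \<open>s\<close> consecutive integers contains at most one solution \<open>l\<close>. The condition \<open>l \<ge> s\<close> excludes the
  block that starts at \<open>0\<close>, which removes the usual error term \<open>+1\<close>.
\<close>
lemma card_residue_le:
  assumes s: "prime s" and r: "r \<noteq> 0"
  shows "finite {l. s \<le> l \<and> l \<le> Y \<and> (k * l) mod s = r}"
    and "card {l. s \<le> l \<and> l \<le> Y \<and> (k * l) mod s = r} \<le> Y div s"
proof -
  let ?S = "{l. s \<le> l \<and> l \<le> Y \<and> (k * l) mod s = r}"
  have s0: "s > 0" using s by (rule prime_gt_0_nat)
  show "finite ?S" by (rule finite_subset[of _ "{..Y}"]) auto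
  have "card ?S \<le> card {1..Y div s}"
  proof (rule card_inj_on_le[of "\<lambda>l. l div s"])
    show "inj_on (\<lambda>l. l div s) ?S"
    proof (rule inj_onI)
      fix x y assume xy: "x \<in> ?S" "y \<in> ?S" "x div s = y div s"
      have "\<not> s dvd k"
      proof
        assume "s dvd k"
        then have "(k * x) mod s = 0" by simp
        then show False using xy r by simp
      qed
      then have "coprime k s" using prime_imp_coprime[OF s] coprime_commute by blast
      moreover have "[k * x = k * y] (mod s)" using xy by (simp add: cong_def)
      ultimately have "x mod s = y mod s" by (simp add: cong_mult_lcancel_nat cong_def [symmetric])
      then show "x = y" using xy(3) by (metis div_mult_mod_eq)
    qed
    show "(\<lambda>l. l div s) ` ?S \<subseteq> {1..Y div s}"
    proof safe
      fix l assume "s \<le> l" "l \<le> Y"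
      then show "l div s \<in> {1..Y div s}"
        using div_le_mono[of l Y s] div_greater_zero_iff[of l s] s0 by simp
    qed
  qed auto
  then show "card ?S \<le> Y div s" by simp
qed

lemma sum_prime_reciprocals_le:
  fixes a :: real
  assumes "a > 1"
  shows "(\<Sum>p | prime p \<and> a \<le> real p \<and> p \<le> n. 1 / real p) \<le> mertens_sum n / ln a"
proof -
  have "(\<Sum>p | prime p \<and> a \<le> real p \<and> p \<le> n. 1 / real p)
      \<le> (\<Sum>p | prime p \<and> a \<le> real p \<and> p \<le> n. ln (real p) / real p / ln a)"
  proof (rule sum_mono)
    fix p assume p: "p \<in> {p. prime p \<and> a \<le> real p \<and> p \<le> n}"
    have "ln a \<le> ln (real p)" using p assms by simp
    moreover have "ln a > 0" using assms by simp
    ultimately have "1 \<le> ln (real p) / ln a" by simp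
    then have "1 / real p \<le> (ln (real p) / ln a) / real p" by (rule divide_right_mono) simp
    then show "1 / real p \<le> ln (real p) / real p / ln a" by (simp add: divide_divide_eq_left mult.commute)
  qed
  also have "\<dots> \<le> (\<Sum>p | prime p \<and> p \<le> n. ln (real p) / real p / ln a)"
  proof (rule sum_mono2)
    fix p assume "p \<in> {p. prime p \<and> p \<le> n} - {p. prime p \<and> a \<le> real p \<and> p \<le> n}"
    then have "p > 0" by (simp add: prime_gt_0_nat)
    then show "0 \<le> ln (real p) / real p / ln a" using assms by simp
  qed auto
  also have "\<dots> = mertens_sum n / ln a" by (simp add: mertens_sum_def sum_divide_distrib)
  finally show ?thesis .
qed

lemma B_imp_pos: "m \<in> B \<epsilon> N \<Longrightarrow> m \<ge> 1"
  by (auto simp: B_def binary_def prime_gt_0_nat Suc_le_eq)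

lemma B_subset: "B \<epsilon> N \<subseteq> {1..nat \<lfloor>N\<rfloor>}"
proof
  fix m assume m: "m \<in> B \<epsilon> N"
  then have "real m < N" by (simp add: B_def)
  then have "m \<le> nat \<lfloor>N\<rfloor>" by (simp add: le_nat_floor)
  then show "m \<in> {1..nat \<lfloor>N\<rfloor>}" using B_imp_pos[OF m] by simp
qed

lemma finite_B: "finite (B \<epsilon> N)"
  using B_subset by (rule finite_subset) simp

lemma card_B_le:
  assumes "N \<ge> 0"
  shows "real (card (B \<epsilon> N)) \<le> N"
proof -
  have "card (B \<epsilon> N) \<le> nat \<lfloor>N\<rfloor>" using card_mono[OF _ B_subset] by fastforce
  then have "real (card (B \<epsilon> N)) \<le> real (nat \<lfloor>N\<rfloor>)" by simp
  also have "\<dots> \<le> N" using assms by simp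
  finally show ?thesis .
qed

lemma binary_ordered:
  assumes "binary m"
  obtains s l where "prime s" "prime l" "s < l" "m = s * l"
  using assms unfolding binary_def by (metis mult.commute nat_neq_iff)

text \<open>
  Here \<open>s\<close> is the smaller prime, \<open>l\<close> the larger one and \<open>k\<close> the multiplier from
  \<open>small_multiple_of_theta\<close>. Since \<open>l \<ge> N / (2s)\<close> in the dyadic range, the bound on \<open>kl\<close> becomes
  \<open>k \<le> s / a\<close> with \<open>a\<close> as below; in particular \<open>s \<ge> a\<close>, which keeps \<open>ln s\<close> comparable to \<open>ln N\<close> and
  bounds the final sum of \<open>1 / s\<close> by a constant.
\<close>
lemma card_B_dyadic:
  fixes \<epsilon> :: real
  assumes e: "0 < \<epsilon>" "\<epsilon> < 1/2" and N: "ln N \<ge> 2 * ln 4 * (1 + 1 / (1/2 - \<epsilon>))" "N \<ge> 1"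
  shows "real (card {m \<in> B \<epsilon> N. N / 2 \<le> real m}) \<le> 8 / (1/2 - \<epsilon>) * N powr (1/2 + \<epsilon>)"
proof -
  define \<beta> where "\<beta> = 1/2 - \<epsilon>"
  define a where "a = N powr \<beta> / 4"
  define n where "n = nat \<lfloor>sqrt N\<rfloor>"
  define P where "P = {s. prime s \<and> a \<le> real s \<and> s \<le> n}"
  define K where "K = (\<lambda>s::nat. nat \<lfloor>real s / a\<rfloor>)"
  define Y where "Y = (\<lambda>s::nat. nat \<lfloor>N / real s\<rfloor>)"
  define S where "S = (\<lambda>s k r. {l. s \<le> l \<and> l \<le> Y s \<and> (k * l) mod s = r})"
  have \<beta>: "\<beta> > 0" "1 - \<beta> = 1/2 + \<epsilon>" using e by (simp_all add: \<beta>_def)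
  have a0: "a > 0" using N by (simp add: a_def)
  have finP: "finite P" by (simp add: P_def)
  have cover: "{m \<in> B \<epsilon> N. N / 2 \<le> real m}
      \<subseteq> (\<Union>s\<in>P. \<Union>k\<in>{1..K s}. \<Union>r\<in>{1, s - 1}. (\<lambda>l. s * l) ` S s k r)"
  proof
    fix m assume "m \<in> {m \<in> B \<epsilon> N. N / 2 \<le> real m}"
    then have m: "binary m" "real m < N" "real (theta m) < real m powr (1/2 + \<epsilon>)" "N / 2 \<le> real m"
      by (simp_all add: B_def)
    obtain s l where sl: "prime s" "prime l" "s < l" "m = s * l" using m(1) by (rule binary_ordered)
    have pos: "s > 1" "l > 1" using sl prime_gt_1_nat by blast+
    obtain k where k: "k \<ge> 1" "k * l \<le> theta m + 1" "(k * l) mod s = 1 \<or> (k * l) mod s = s - 1"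
      using small_multiple_of_theta[of s l] sl by auto
    have "real (k * l) \<le> real (theta m) + 1" using k(2) by linarith
    also have "\<dots> \<le> real m powr (1/2 + \<epsilon>) + 1" using m by simp
    also have "\<dots> \<le> 2 * N powr (1/2 + \<epsilon>)"
    proof -
      have "real m powr (1/2 + \<epsilon>) \<le> N powr (1/2 + \<epsilon>)" using m e by (intro powr_mono2) auto
      moreover have "1 \<le> N powr (1/2 + \<epsilon>)" using N e by (intro ge_one_powr_ge_zero) auto
      ultimately show ?thesis by simp
    qed
    finally have kl: "real k * real l \<le> 2 * N powr (1/2 + \<epsilon>)" by simp
    have "real k * N \<le> real k * (2 * (real s * real l))" 
      using m sl by (intro mult_left_mono) auto
    also have "\<dots> = 2 * real s * (real k * real l)" by simp
    also have "\<dots> \<le> 2 * real s * (2 * N powr (1/2 + \<epsilon>))" using kl by (intro mult_left_mono) auto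
    finally have "real k * N \<le> 4 * real s * N powr (1/2 + \<epsilon>)" by simp
    moreover have "N = N powr \<beta> * N powr (1/2 + \<epsilon>)"
      using N by (simp add: powr_add [symmetric] \<beta>_def)
    ultimately have "(real k * N powr \<beta>) * N powr (1/2 + \<epsilon>) \<le> (4 * real s) * N powr (1/2 + \<epsilon>)"
      by (simp only: mult.assoc)
    moreover have "N powr (1/2 + \<epsilon>) > 0" using N by simp
    ultimately have "real k * N powr \<beta> \<le> 4 * real s" by (simp only: mult_le_cancel_right)
    then have ka: "real k * a \<le> real s" by (simp add: a_def)
    then have "real k \<le> real s / a" using a0 by (simp add: pos_le_divide_eq)
    then have "k \<le> K s" by (simp add: K_def le_nat_floor)
    moreover have "s \<in> P"
    proof -
      have "1 * a \<le> real k * a" using k a0 by (intro mult_right_mono) auto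
      moreover have "s * s \<le> s * l" using sl by simp
      then have "real s * real s \<le> N" using m sl by (metis of_nat_le_iff of_nat_mult order.trans less_imp_le)
      then have "real s \<le> sqrt N" by (simp add: real_le_rsqrt power2_eq_square)
      then have "s \<le> n" by (simp add: n_def le_nat_floor)
      ultimately show ?thesis using ka sl by (simp add: P_def)
    qed
    moreover have "l \<le> Y s"
    proof -
      have "real l \<le> N / real s" using m sl pos by (simp add: pos_le_divide_eq mult.commute)
      then show ?thesis by (simp add: Y_def le_nat_floor)
    qed
    then have "l \<in> S s k ((k * l) mod s)" using sl by (simp add: S_def)
    moreover have "(k * l) mod s \<in> {1, s - 1}" "k \<in> {1..K s}" using k \<open>k \<le> K s\<close> by simp_all
    ultimately show "m \<in> (\<Union>s\<in>P. \<Union>k\<in>{1..K s}. \<Union>r\<in>{1, s - 1}. (\<lambda>l. s * l) ` S s k r)"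
      using sl(4) by blast
  qed
  have S: "finite (S s k r)" "card (S s k r) \<le> Y s div s" if "s \<in> P" "r \<in> {1, s - 1}" for s k r
  proof -
    have "prime s" using that by (simp add: P_def)
    moreover have "r \<noteq> 0" using that prime_gt_1_nat[OF \<open>prime s\<close>] by auto
    ultimately show "finite (S s k r)" "card (S s k r) \<le> Y s div s"
      unfolding S_def by (rule card_residue_le)+
  qed
  have inner: "card (\<Union>r\<in>{1, s - 1}. (\<lambda>l. s * l) ` S s k r) \<le> 2 * (Y s div s)" if "s \<in> P" for s k
  proof -
    have "card ((\<lambda>l. s * l) ` S s k r) \<le> Y s div s" if "r \<in> {1, s - 1}" for r
      using S[OF \<open>s \<in> P\<close> that] card_image_le by (meson le_trans)
    then have "card ((\<lambda>l. s * l) ` S s k 1) + card ((\<lambda>l. s * l) ` S s k (s - 1)) \<le> 2 * (Y s div s)"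
      by (metis add_mono insertCI mult_2)
    moreover have "(\<Union>r\<in>{1, s - 1}. (\<lambda>l. s * l) ` S s k r)
        = (\<lambda>l. s * l) ` S s k 1 \<union> (\<lambda>l. s * l) ` S s k (s - 1)" by simp
    ultimately show ?thesis by (metis card_Un_le le_trans)
  qed
  have "card {m \<in> B \<epsilon> N. N / 2 \<le> real m}
      \<le> card (\<Union>s\<in>P. \<Union>k\<in>{1..K s}. \<Union>r\<in>{1, s - 1}. (\<lambda>l. s * l) ` S s k r)"
    using finP S(1) by (intro card_mono cover finite_UN_I finite_imageI) auto
  also have "\<dots> \<le> (\<Sum>s\<in>P. card (\<Union>k\<in>{1..K s}. \<Union>r\<in>{1, s - 1}. (\<lambda>l. s * l) ` S s k r))"
    by (rule card_UN_le[OF finP])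
  also have "\<dots> \<le> (\<Sum>s\<in>P. K s * (2 * (Y s div s)))"
  proof (rule sum_mono)
    fix s assume s: "s \<in> P"
    have "card (\<Union>k\<in>{1..K s}. \<Union>r\<in>{1, s - 1}. (\<lambda>l. s * l) ` S s k r)
        \<le> (\<Sum>k\<in>{1..K s}. card (\<Union>r\<in>{1, s - 1}. (\<lambda>l. s * l) ` S s k r))"
      by (rule card_UN_le) simp
    also have "\<dots> \<le> (\<Sum>k\<in>{1..K s}. 2 * (Y s div s))" by (intro sum_mono inner s)
    finally show "card (\<Union>k\<in>{1..K s}. \<Union>r\<in>{1, s - 1}. (\<lambda>l. s * l) ` S s k r) \<le> K s * (2 * (Y s div s))"
      by simp
  qed
  finally have "real (card {m \<in> B \<epsilon> N. N / 2 \<le> real m}) \<le> real (\<Sum>s\<in>P. K s * (2 * (Y s div s)))"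
    by (simp only: of_nat_le_iff)
  also have "\<dots> = (\<Sum>s\<in>P. real (K s) * (2 * real (Y s div s)))" by simp
  also have "\<dots> \<le> (\<Sum>s\<in>P. (real s / a) * (2 * (N / real s / real s)))"
  proof (rule sum_mono)
    fix s assume "s \<in> P"
    have K: "real (K s) \<le> real s / a" using a0 by (simp add: K_def)
    have "real (Y s) \<le> N / real s" using N by (simp add: Y_def)
    then have "real (Y s) / real s \<le> N / real s / real s" by (rule divide_right_mono) simp
    moreover have "real (Y s div s) \<le> real (Y s) / real s" by (rule of_nat_div_le_of_nat)
    ultimately have "2 * real (Y s div s) \<le> 2 * (N / real s / real s)" by linarith
    with K show "real (K s) * (2 * real (Y s div s)) \<le> (real s / a) * (2 * (N / real s / real s))"
      by (rule mult_mono) (use a0 in simp_all)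
  qed
  also have "\<dots> = (\<Sum>s\<in>P. (2 * N / a) * (1 / real s))"
  proof (rule sum.cong[OF refl])
    fix s assume "s \<in> P"
    then have "real s > 0" by (simp add: P_def prime_gt_0_nat)
    then show "(real s / a) * (2 * (N / real s / real s)) = (2 * N / a) * (1 / real s)"
      using a0 by (simp add: field_simps)
  qed
  also have "\<dots> = (2 * N / a) * (\<Sum>s\<in>P. 1 / real s)" by (simp add: sum_distrib_left)
  also have "\<dots> \<le> (2 * N / a) * (1 / \<beta>)"
  proof (rule mult_left_mono)
    have lnN: "2 * ln 4 * (1 + 1 / \<beta>) \<le> ln N" using N by (simp add: \<beta>_def)
    have lna: "ln a = \<beta> * ln N - ln 4" using N by (simp add: a_def ln_div ln_powr)
    have "\<beta> * (2 * ln 4 * (1 + 1 / \<beta>)) \<le> \<beta> * ln N" using lnN \<beta> by (intro mult_left_mono) auto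
    moreover have "\<beta> * (2 * ln 4 * (1 + 1 / \<beta>)) = 2 * ln 4 * \<beta> + 2 * ln 4" using \<beta> by (simp add: field_simps)
    moreover have "2 * ln 4 * \<beta> > 0" "ln (4 :: real) > 0" using \<beta> by simp_all
    ultimately have lna0: "ln a > 0" unfolding lna by linarith
    then have a1: "a > 1" using a0 by (simp add: ln_gt_zero_iff)
    have n1: "real n \<le> sqrt N" "n \<ge> 1" using N by (simp_all add: n_def le_nat_floor)
    have "(\<Sum>s\<in>P. 1 / real s) \<le> mertens_sum n / ln a"
      unfolding P_def by (rule sum_prime_reciprocals_le[OF a1])
    also have "\<dots> \<le> (1 / \<beta> * ln a) / ln a"
    proof (rule divide_right_mono)
      have "mertens_sum n \<le> ln (real n) + ln 4" by (rule mertens_upper)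
      also have "ln (real n) \<le> ln (sqrt N)" using n1 N by (subst ln_le_cancel_iff) auto
      also have "ln (sqrt N) = ln N / 2" using N by (simp add: ln_sqrt)
      also have "ln N / 2 + ln 4 \<le> ln N - ln 4 / \<beta>" using lnN by (simp add: algebra_simps)
      also have "\<dots> = 1 / \<beta> * ln a" using \<beta> by (simp add: lna field_simps)
      finally show "mertens_sum n \<le> 1 / \<beta> * ln a" by simp
    qed (use lna0 in simp)
    also have "\<dots> = 1 / \<beta>" using lna0 by simp
    finally show "(\<Sum>s\<in>P. 1 / real s) \<le> 1 / \<beta>" .
  qed (use a0 N in simp)
  also have "2 * N / a = 8 * N powr (1/2 + \<epsilon>)"
    using N by (simp add: a_def \<beta>(2) [symmetric] powr_diff)
  finally show ?thesis by (simp add: \<beta>_def)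
qed

text \<open>
  The dyadic bounds form a geometric series. The constant \<open>C\<close> is the fixed point of
  \<open>C \<mapsto> C * 2 powr (-\<alpha>) + C1\<close>, so it reproduces itself when \<open>N\<close> is doubled.
\<close>
lemma card_B_upper:
  fixes \<epsilon> :: real
  assumes e: "0 < \<epsilon>" "\<epsilon> < 1/2"
  shows "\<exists>C>0. \<forall>N>0. real (card (B \<epsilon> N)) \<le> C * N powr (1/2 + \<epsilon>)"
proof -
  define \<alpha> where "\<alpha> = 1/2 + \<epsilon>"
  \<comment> \<open>The range in which \<open>card_B_dyadic\<close> applies; below it, the trivial bound \<open>N\<close> is absorbed into \<open>C1\<close>.\<close>
  define N1 where "N1 = exp (2 * ln 4 * (1 + 1 / (1/2 - \<epsilon>)))"
  define C1 where "C1 = 8 / (1/2 - \<epsilon>) + N1"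
  define C where "C = C1 / (1 - 2 powr (-\<alpha>))"
  have \<alpha>: "\<alpha> > 0" using e by (simp add: \<alpha>_def)
  have N1: "N1 > 0" by (simp add: N1_def)
  have "8 / (1/2 - \<epsilon>) > 0" using e by simp
  then have C1: "C1 > 0" "C1 \<ge> N1" "C1 \<ge> 8 / (1/2 - \<epsilon>)" using N1 unfolding C1_def by linarith+
  have half: "2 powr (-\<alpha>) < 1" using \<alpha> powr_less_cancel_iff[of 2 "-\<alpha>" 0] by simp
  have "C * (1 - 2 powr (-\<alpha>)) = C1" using half \<alpha> by (simp add: C_def)
  then have C: "C * 2 powr (-\<alpha>) + C1 = C" by (simp add: algebra_simps)
  have C0: "C > 0" using C1 half by (simp add: C_def)
  have dy: "real (card {m \<in> B \<epsilon> N. N / 2 \<le> real m}) \<le> C1 * N powr \<alpha>" if "N \<ge> 1" for N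
  proof (cases "N1 \<le> N")
    case True
    then have "ln N1 \<le> ln N" using N1 by simp
    then have "real (card {m \<in> B \<epsilon> N. N / 2 \<le> real m}) \<le> 8 / (1/2 - \<epsilon>) * N powr \<alpha>"
      using that unfolding \<alpha>_def by (intro card_B_dyadic e) (simp_all add: N1_def)
    also have "\<dots> \<le> C1 * N powr \<alpha>" by (intro mult_right_mono C1) simp
    finally show ?thesis .
  next
    case False
    have "card {m \<in> B \<epsilon> N. N / 2 \<le> real m} \<le> card (B \<epsilon> N)" by (intro card_mono finite_B) auto
    then have "real (card {m \<in> B \<epsilon> N. N / 2 \<le> real m}) \<le> N"
      using card_B_le[of N \<epsilon>] that by linarith
    also have "\<dots> \<le> C1 * 1" using False C1 by simp
    also have "\<dots> \<le> C1 * N powr \<alpha>"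
      using that \<alpha> C1 by (intro mult_left_mono ge_one_powr_ge_zero) auto
    finally show ?thesis .
  qed
  have main: "real (card (B \<epsilon> N)) \<le> C * N powr \<alpha>" if "0 < N" "N < 2 ^ n" for n N
    using that
  proof (induction n arbitrary: N)
    case 0
    then have "B \<epsilon> N = {}" using B_subset[of \<epsilon> N] by auto
    then show ?case using C0 by simp
  next
    case (Suc n)
    show ?case
    proof (cases "N < 1")
      case True
      then have "B \<epsilon> N = {}" using B_subset[of \<epsilon> N] by auto
      then show ?thesis using C0 by simp
    next
      case False
      have "B \<epsilon> N \<subseteq> B \<epsilon> (N / 2) \<union> {m \<in> B \<epsilon> N. N / 2 \<le> real m}" by (auto simp: B_def)
      then have "card (B \<epsilon> N) \<le> card (B \<epsilon> (N / 2) \<union> {m \<in> B \<epsilon> N. N / 2 \<le> real m})"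
        by (intro card_mono) (simp_all add: finite_B)
      also have "\<dots> \<le> card (B \<epsilon> (N / 2)) + card {m \<in> B \<epsilon> N. N / 2 \<le> real m}" by (rule card_Un_le)
      finally have "real (card (B \<epsilon> N))
          \<le> real (card (B \<epsilon> (N / 2))) + real (card {m \<in> B \<epsilon> N. N / 2 \<le> real m})" by linarith
      also have "\<dots> \<le> C * (N / 2) powr \<alpha> + C1 * N powr \<alpha>"
        using Suc.prems False by (intro add_mono Suc.IH dy) auto
      also have "(N / 2) powr \<alpha> = 2 powr (-\<alpha>) * N powr \<alpha>"
        using Suc.prems by (subst powr_divide) (auto simp: powr_minus_divide)
      also have "C * (2 powr (-\<alpha>) * N powr \<alpha>) + C1 * N powr \<alpha> = (C * 2 powr (-\<alpha>) + C1) * N powr \<alpha>"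
        by (simp only: distrib_right mult.assoc)
      finally show ?thesis by (simp only: C)
    qed
  qed
  have "real (card (B \<epsilon> N)) \<le> C * N powr \<alpha>" if "N > 0" for N
  proof -
    obtain n where "N < 2 ^ n" using real_arch_pow[of 2 N] by auto
    then show ?thesis using main that by blast
  qed
  then show ?thesis using C0 unfolding \<alpha>_def by blast
qed

lemma powr_bigo_div_ln_squared:
  assumes "\<alpha> < (1::real)"
  shows "(\<lambda>N. N powr \<alpha>) \<in> O(\<lambda>N. N / (ln N)\<^sup>2)"
  using assms by real_asymp

section \<open>Integers with a large prime factor\<close>

text \<open>
  If \<open>M\<close> is the product of such a set \<open>A\<close>, then \<open>M\<close> together with the translates \<open>M + a\<close> is a
  set of the same kind with one more element: the new differences are the old ones and the elements of
  \<open>A\<close>, all of which divide \<open>M\<close>.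
\<close>
lemma exists_difference_divides_set:
  "\<exists>A :: nat set. finite A \<and> card A = k \<and> (\<forall>a\<in>A. 0 < a) \<and>
     (\<forall>a\<in>A. \<forall>b\<in>A. a < b \<longrightarrow> (b - a) dvd a)"
proof (induction k)
  case 0
  show ?case by (intro exI[of _ "{}"]) simp
next
  case (Suc k)
  then obtain A :: "nat set" where A: "finite A" "card A = k" "\<And>a. a \<in> A \<Longrightarrow> 0 < a"
    and dv: "\<And>a b. a \<in> A \<Longrightarrow> b \<in> A \<Longrightarrow> a < b \<Longrightarrow> (b - a) dvd a" by blast
  define M where "M = \<Prod>A"
  have M: "M > 0" using A by (auto simp: M_def intro!: prod_pos)
  have dvdM: "a dvd M" if "a \<in> A" for a unfolding M_def using A(1) that by (rule dvd_prodI)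
  define A' where "A' = insert M ((\<lambda>a. M + a) ` A)"
  have "M \<notin> (\<lambda>a. M + a) ` A" using A(3)[of 0] by auto
  then have "card A' = Suc k" using A by (simp add: A'_def card_image)
  moreover have "(b - a) dvd a" if ab: "a \<in> A'" "b \<in> A'" "a < b" for a b
  proof -
    obtain d where d: "b = M + d" "d \<in> A" using ab by (auto simp: A'_def)
    show ?thesis
    proof (cases "a = M")
      case True
      then show ?thesis using d dvdM by simp
    next
      case False
      then obtain c where c: "a = M + c" "c \<in> A" using ab by (auto simp: A'_def)
      have "c < d" using c d ab by simp
      then have "(d - c) dvd c" using dv c d by blast
      then have "(d - c) dvd M" using dvdM[OF c(2)] by (rule dvd_trans)
      then show ?thesis using c d \<open>(d - c) dvd c\<close> by simp
    qed
  qed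
  moreover have "finite A'" "\<forall>a\<in>A'. 0 < a" using A M by (auto simp: A'_def)
  ultimately show ?case by blast
qed

lemma card_solutions_ge:
  assumes p: "prime p" and "\<not> p dvd M"
  shows "x div p \<le> card {t \<in> {1..x}. p dvd M * t + 1}"
proof -
  have p1: "p > 1" using p by (rule prime_gt_1_nat)
  have "coprime M p" using prime_imp_coprime[OF assms] coprime_commute by blast
  then obtain z where z: "[M * z = 1] (mod p)" using cong_solve_coprime_nat by auto
  define r where "r = ((p - 1) * z) mod p"
  have "[M * r + 1 = (p - 1) * (M * z) + 1] (mod p)"
    unfolding r_def by (intro cong_add) (simp_all add: cong_def mod_mult_right_eq mult_ac)
  also have "[(p - 1) * (M * z) + 1 = (p - 1) * 1 + 1] (mod p)"
    by (intro cong_add cong_mult z) simp_all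
  also have "(p - 1) * 1 + 1 = p" using p1 by simp
  finally have dvd: "p dvd M * r + 1" by (simp add: cong_def mod_eq_0_iff_dvd)
  have "r \<noteq> 0"
  proof
    assume "r = 0"
    then show False using dvd p1 by simp
  qed
  moreover have "r < p" using p1 by (simp add: r_def)
  ultimately have r: "1 \<le> r" "r \<le> p" by simp_all
  have "card {..<x div p} \<le> card {t \<in> {1..x}. p dvd M * t + 1}"
  proof (rule card_inj_on_le[of "\<lambda>i. r + p * i"])
    show "inj_on (\<lambda>i. r + p * i) {..<x div p}" using p1 by (simp add: inj_on_def)
    show "(\<lambda>i. r + p * i) ` {..<x div p} \<subseteq> {t \<in> {1..x}. p dvd M * t + 1}"
    proof (rule image_subsetI)
      fix i assume "i \<in> {..<x div p}"
      then have "p * (i + 1) \<le> p * (x div p)" by (intro mult_left_mono) auto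
      also have "\<dots> \<le> x" by simp
      finally have "r + p * i \<le> x" using r by simp
      moreover have "M * (r + p * i) + 1 = (M * r + 1) + p * (M * i)" by (simp add: algebra_simps)
      then have "p dvd M * (r + p * i) + 1" using dvd by (metis dvd_add dvd_triv_left)
      ultimately show "r + p * i \<in> {t \<in> {1..x}. p dvd M * t + 1}" using r by simp
    qed
  qed simp
  then show ?thesis by simp
qed

definition large_factor_set :: "real \<Rightarrow> nat \<Rightarrow> nat \<Rightarrow> nat set" where
  "large_factor_set y M x =
     {t \<in> {1..x}. \<exists>p. prime p \<and> y < real p \<and> p \<le> x \<and> p dvd M * t + 1}"

text \<open>
  Two different primes above \<open>y\<close> cannot both divide \<open>M * t + 1\<close>, which is at most \<open>y\<^sup>2\<close>. So the sets of
  \<open>t\<close> belonging to different primes \<open>p\<close> are disjoint; each of them has at least \<open>x div p\<close>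
  elements, which is at least \<open>x / (2 p)\<close> as \<open>p \<le> x\<close>.
\<close>
lemma card_large_factor_set_ge:
  fixes y :: real
  assumes y: "real M \<le> y" "real (M * x + 1) \<le> y\<^sup>2" "1 \<le> y" and M: "0 < M"
  shows "(\<Sum>p | prime p \<and> y < real p \<and> p \<le> x. real x / (2 * real p)) \<le> real (card (large_factor_set y M x))"
proof -
  define P where "P = {p. prime p \<and> y < real p \<and> p \<le> x}"
  define T where "T = (\<lambda>p. {t \<in> {1..x}. p dvd M * t + 1})"
  have finP: "finite P" by (simp add: P_def)
  have eq: "large_factor_set y M x = (\<Union>p\<in>P. T p)"
    by (auto simp: large_factor_set_def P_def T_def)
  have disj: "T p \<inter> T p' = {}" if pp: "p \<in> P" "p' \<in> P" "p \<noteq> p'" for p p'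
  proof (rule ccontr)
    assume "T p \<inter> T p' \<noteq> {}"
    then obtain t where t: "t \<le> x" "p dvd M * t + 1" "p' dvd M * t + 1" by (auto simp: T_def)
    have pr: "prime p" "prime p'" "y < real p" "y < real p'" using pp by (simp_all add: P_def)
    have "coprime p p'" using pr pp by (intro primes_coprime)
    then have "p * p' dvd M * t + 1" using t by (intro divides_mult)
    then have "p * p' \<le> M * t + 1" by (rule dvd_imp_le) simp
    also have "\<dots> \<le> M * x + 1" using t by simp
    finally have "real (p * p') \<le> real (M * x + 1)" by (simp only: of_nat_le_iff)
    also have "\<dots> \<le> y * y" using y by (simp add: power2_eq_square)
    also have "y * y < real p * real p'" using pr y by (intro mult_strict_mono) auto
    finally show False by simp
  qed
  have "(\<Sum>p\<in>P. real x / (2 * real p)) \<le> (\<Sum>p\<in>P. real (card (T p)))"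
  proof (rule sum_mono)
    fix p assume "p \<in> P"
    then have p: "prime p" "y < real p" "p \<le> x" by (simp_all add: P_def)
    have "M < p" using p y by linarith
    then have "\<not> p dvd M" using M dvd_imp_le by fastforce
    then have c: "x div p \<le> card (T p)" unfolding T_def by (rule card_solutions_ge[OF p(1)])
    have p0: "p > 0" using p(1) by (rule prime_gt_0_nat)
    have d1: "1 \<le> x div p" using p(3) p0 by (simp add: Suc_le_eq div_greater_zero_iff)
    have "real x / real p - 1 \<le> real (x div p)" by (rule real_nat_div_ge)
    then have "real x / real p \<le> 2 * real (x div p)" using d1 by linarith
    then have "real x / (2 * real p) \<le> real (x div p)" by simp
    then show "real x / (2 * real p) \<le> real (card (T p))" using c by linarith
  qed
  also have "\<dots> = real (\<Sum>p\<in>P. card (T p))" by simp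
  also have "(\<Sum>p\<in>P. card (T p)) = card (\<Union>p\<in>P. T p)"
    using finP disj by (intro card_UN_disjoint[symmetric]) (auto simp: T_def)
  finally show ?thesis by (simp add: eq P_def)
qed

text \<open>
  Both Mertens estimates have leading coefficient \<open>1\<close>, so the sum of \<open>ln p / p\<close> over the primes in this
  range is at least \<open>\<delta> ln x\<close> up to a constant; each \<open>ln p\<close> is at most \<open>ln x\<close>.
\<close>
lemma sum_large_prime_reciprocals_ge:
  fixes \<delta> :: real
  assumes d: "0 < \<delta>" "\<delta> < 1"
  shows "\<forall>\<^sub>F x::nat in sequentially.
    \<delta> / 2 \<le> (\<Sum>p | prime p \<and> real x powr (1 - \<delta>) < real p \<and> p \<le> x. 1 / real p)"
proof -
  obtain C where C: "\<And>n. n \<ge> 1 \<Longrightarrow> ln (real n) - C \<le> mertens_sum n" using mertens_lower by blast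
  have "\<forall>\<^sub>F x::nat in sequentially. \<delta> / 2 * ln (real x) \<ge> C + ln 4" using d by real_asymp
  moreover have "\<forall>\<^sub>F x::nat in sequentially. x \<ge> 2" by (rule eventually_ge_at_top)
  ultimately show ?thesis
  proof eventually_elim
    case (elim x)
    define y where "y = real x powr (1 - \<delta>)"
    define n where "n = nat \<lfloor>y\<rfloor>"
    define P where "P = {p. prime p \<and> y < real p \<and> p \<le> x}"
    have lnx: "ln (real x) > 0" using elim by simp
    have y1: "y \<ge> 1" using elim d by (simp add: y_def ge_one_powr_ge_zero)
    have yx: "y \<le> real x" using elim d powr_mono[of "1 - \<delta>" 1 "real x"] by (simp add: y_def)
    have n: "real n \<le> y" "n \<ge> 1" using y1 by (simp_all add: n_def le_nat_floor)
    have lny: "ln y = (1 - \<delta>) * ln (real x)" using elim by (simp add: y_def ln_powr)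
    have "mertens_sum n \<le> ln (real n) + ln 4" by (rule mertens_upper)
    also have "ln (real n) \<le> ln y" using n y1 by (subst ln_le_cancel_iff) auto
    finally have up: "mertens_sum n \<le> (1 - \<delta>) * ln (real x) + ln 4" by (simp add: lny)
    have lo: "ln (real x) - C \<le> mertens_sum x" using elim by (intro C) simp
    have "{p. prime p \<and> p \<le> x} = {p. prime p \<and> p \<le> n} \<union> P"
      using yx n(1) by (auto simp: P_def n_def le_nat_floor le_nat_iff le_floor_iff)
    moreover have "{p. prime p \<and> p \<le> n} \<inter> P = {}" using n(1) by (auto simp: P_def)
    ultimately have "mertens_sum x = mertens_sum n + (\<Sum>p\<in>P. ln (real p) / real p)"
      unfolding mertens_sum_def by (simp add: sum.union_disjoint P_def)
    then have "\<delta> / 2 * ln (real x) \<le> (\<Sum>p\<in>P. ln (real p) / real p)"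
      using up lo elim by (simp add: algebra_simps)
    also have "\<dots> \<le> (\<Sum>p\<in>P. ln (real x) * (1 / real p))"
    proof (rule sum_mono)
      fix p assume "p \<in> P"
      then have "p > 0" "p \<le> x" by (simp_all add: P_def prime_gt_0_nat)
      then have "ln (real p) \<le> ln (real x)" by simp
      then show "ln (real p) / real p \<le> ln (real x) * (1 / real p)"
        by (simp add: divide_right_mono)
    qed
    also have "\<dots> = (\<Sum>p\<in>P. 1 / real p) * ln (real x)"
      by (simp add: sum_distrib_left mult.commute)
    finally have "\<delta> / 2 \<le> (\<Sum>p\<in>P. 1 / real p)" using lnx by (simp only: mult_le_cancel_right_pos)
    then show ?case by (simp add: P_def y_def)
  qed
qed

lemma eventually_linear_le_powr:
  fixes c K :: real
  assumes "c > 1" "K > 0"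
  shows "\<forall>\<^sub>F x::nat in sequentially. K * real x \<le> real x powr c"
  using assms by real_asymp

lemma card_large_factor_set_linear:
  fixes \<delta> :: real
  assumes d: "0 < \<delta>" "\<delta> < 1/2" and M: "M > 0"
  shows "\<forall>\<^sub>F x::nat in sequentially.
    \<delta> / 4 * real x \<le> real (card (large_factor_set (real x powr (1 - \<delta>)) M x))"
proof -
  have "\<forall>\<^sub>F x::nat in sequentially. real M \<le> real x powr (1 - \<delta>)" using d by real_asymp
  moreover have "\<forall>\<^sub>F x::nat in sequentially. 2 * real M * real x \<le> real x powr (2 * (1 - \<delta>))"
    using d M by (intro eventually_linear_le_powr) auto
  moreover have "\<forall>\<^sub>F x::nat in sequentially.
    \<delta> / 2 \<le> (\<Sum>p | prime p \<and> real x powr (1 - \<delta>) < real p \<and> p \<le> x. 1 / real p)"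
    using d by (intro sum_large_prime_reciprocals_ge) auto
  moreover have "\<forall>\<^sub>F x::nat in sequentially. x \<ge> 1" by (rule eventually_ge_at_top)
  ultimately show ?thesis
  proof eventually_elim
    case (elim x)
    define y where "y = real x powr (1 - \<delta>)"
    have sq: "y\<^sup>2 = real x powr (2 * (1 - \<delta>))"
      by (simp add: y_def power2_eq_square powr_add [symmetric])
    have "1 \<le> M * x" using M elim by simp
    then have "M * x + 1 \<le> 2 * (M * x)" by linarith
    then have "real (M * x + 1) \<le> real (2 * (M * x))" by (simp only: of_nat_le_iff)
    then have "real (M * x + 1) \<le> y\<^sup>2" using elim(2) sq by simp
    moreover have "1 \<le> y" using elim M by (simp add: y_def)
    ultimately have "(\<Sum>p | prime p \<and> y < real p \<and> p \<le> x. real x / (2 * real p))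
        \<le> real (card (large_factor_set y M x))"
      using M elim(1) by (intro card_large_factor_set_ge) (simp_all add: y_def)
    moreover have "(\<Sum>p | prime p \<and> y < real p \<and> p \<le> x. real x / (2 * real p))
        = real x / 2 * (\<Sum>p | prime p \<and> y < real p \<and> p \<le> x. 1 / real p)"
      by (simp add: sum_distrib_left)
    moreover have "real x / 2 * (\<delta> / 2)
        \<le> real x / 2 * (\<Sum>p | prime p \<and> y < real p \<and> p \<le> x. 1 / real p)"
      using elim(3) unfolding y_def by (rule mult_left_mono) simp
    ultimately show ?case by (simp add: y_def mult.commute)
  qed
qed

section \<open>The lower bound\<close>

text \<open>
  The numbers \<open>a (M t + 1)\<close> and \<open>b (M' t + 1)\<close> differ by \<open>b - a\<close>, which divides \<open>a\<close> and \<open>b\<close>. After division by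
  \<open>b - a\<close> they are consecutive multiples \<open>e p\<close> and \<open>la q\<close> of the two primes. The
  equation \<open>la q = e p + 1\<close> yields the pair \<open>(la, q - e)\<close> that determines \<open>theta\<close>.
\<close>
lemma theta_le_of_consecutive_multiples:
  fixes p q a b M M' t :: nat
  assumes p: "prime p" "p dvd M * t + 1" and q: "prime q" "q dvd M' * t + 1"
    and ab: "0 < a" "a < b" "(b - a) dvd a" and eq: "a * M = b * M'"
    and small: "b * (M' * t + 1) < p * q"
  shows "p \<noteq> q" and "theta (p * q) < 2 * (b * (M' * t + 1))"
proof -
  define d where "d = b - a"
  obtain c where c: "a = d * c" using ab by (auto simp: d_def)
  have d0: "d > 0" using ab by (simp add: d_def)
  have c0: "c > 0" using c ab by (cases c) auto
  have b: "b = d * (c + 1)" using c ab by (simp add: d_def algebra_simps)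
  obtain u where u: "M * t + 1 = p * u" using p by (auto elim: dvdE)
  obtain v where v: "M' * t + 1 = q * v" using q by (auto elim: dvdE)
  have pq0: "p > 0" "q > 0" using p q by (simp_all add: prime_gt_0_nat)
  have u0: "u > 0" using u by (cases u) auto
  have v0: "v > 0" using v by (cases v) auto
  define la e where "la = (c + 1) * v" and "e = c * u"
  have "d * (la * q) = b * (M' * t + 1)" unfolding la_def b v by (simp only: mult_ac)
  also have "\<dots> = b * M' * t + b" by (simp add: algebra_simps)
  also have "\<dots> = a * M * t + a + d" using ab by (simp add: eq d_def)
  also have "\<dots> = a * (M * t + 1) + d" by (simp add: algebra_simps)
  also have "\<dots> = d * (e * p + 1)" unfolding u c e_def by (simp add: algebra_simps)
  finally have "d * (la * q) = d * (e * p + 1)" .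
  moreover have "d \<noteq> 0" using d0 by simp
  ultimately have key: "la * q = e * p + 1" using mult_left_cancel by blast
  have laq: "la * q \<le> b * (M' * t + 1)"
  proof -
    have "1 * (c + 1) \<le> d * (c + 1)" using d0 by (intro mult_right_mono) auto
    then have "c + 1 \<le> b" using b by simp
    then have "(c + 1) * (q * v) \<le> b * (q * v)" by (rule mult_right_mono) simp
    then show ?thesis by (simp only: la_def v mult_ac)
  qed
  show "p \<noteq> q"
  proof
    assume "p = q"
    then have "p dvd e * p + 1" using key by (metis dvd_triv_right)
    then have "p dvd 1" using dvd_add_right_iff[of p "e * p" 1] dvd_triv_right by blast
    then show False using p prime_gt_1_nat[OF p(1)] by simp
  qed
  have "la * q < p * q" using laq small by linarith
  moreover from this have "e * p < q * p" unfolding key mult.commute[of q p] by linarith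
  ultimately have lap: "la < p" and eq: "e < q" using mult_less_cancel2 by blast+
  obtain mu where mu: "q = e + mu" "mu > 0" using less_imp_add_positive[OF eq] by auto
  have pos: "0 < la" "0 < e" using c0 u0 v0 by (simp_all add: la_def e_def)
  have bez: "la * q + mu * p = p * q + 1" using key mu by (simp add: algebra_simps)
  have "theta (p * q) + 1 = 2 * la * mu"
    using pos mu lap by (intro theta_prime_mult p q \<open>p \<noteq> q\<close> bez) simp_all
  also have "\<dots> \<le> 2 * (la * q)" using mu by simp
  also have "\<dots> \<le> 2 * (b * (M' * t + 1))" using laq by simp
  finally show "theta (p * q) < 2 * (b * (M' * t + 1))" by simp
qed

lemma prime_pair_eq:
  fixes p q p' q' :: nat
  assumes "prime p" "prime q" "prime p'" "prime q'" "p * q = p' * q'"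
    and "p \<noteq> q" "p' \<noteq> q'" "p < q \<longleftrightarrow> p' < q'"
  shows "p = p' \<and> q = q'"
proof -
  have "p dvd p' * q'" using assms(5) by (metis dvd_triv_left)
  then have "p dvd p' \<or> p dvd q'" using assms(1) by (simp add: prime_dvd_mult_iff)
  then have "p = p' \<or> p = q'" using assms(1,3,4) primes_dvd_imp_eq by blast
  moreover have p0: "p > 0" using assms(1) by (rule prime_gt_0_nat)
  moreover have "p \<noteq> q'"
  proof
    assume "p = q'"
    then have "q = p'" using assms(5) p0 by (simp add: mult.commute)
    then show False using \<open>p = q'\<close> assms(6,8) by linarith
  qed
  ultimately show ?thesis using assms(5) by simp
qed

lemma cong_of_common_prime_divisor:
  fixes p M t t' :: nat
  assumes "prime p" "p dvd M * t + 1" "p dvd M * t' + 1"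
  shows "[t = t'] (mod p)"
proof -
  have "\<not> p dvd M"
  proof
    assume "p dvd M"
    then have "p dvd M * t" by simp
    then have "p dvd 1" using assms(2) by (metis dvd_add_right_iff)
    then show False using prime_gt_1_nat[OF assms(1)] by simp
  qed
  then have "coprime M p" using prime_imp_coprime[OF assms(1)] coprime_commute by blast
  moreover have "[M * t + 1 = M * t' + 1] (mod p)"
    using assms(2,3) by (simp add: cong_def mod_eq_0_iff_dvd)
  then have "[M * t = M * t'] (mod p)" by (simp only: cong_add_rcancel_nat)
  ultimately show ?thesis by (simp add: cong_mult_lcancel_nat)
qed

text \<open>
  A point outside the overlap lies in at most one of the sets, any other in at most \<open>card A\<close> of
  them.
\<close>
lemma double_count_overlap:
  fixes T :: "'a \<Rightarrow> nat set"
  assumes fin: "finite A" and T: "\<And>a. a \<in> A \<Longrightarrow> T a \<subseteq> {1..x}"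
  shows "(\<Sum>a\<in>A. card (T a)) \<le> x + card A * card {t \<in> {1..x}. \<exists>a\<in>A. \<exists>b\<in>A. a \<noteq> b \<and> t \<in> T a \<and> t \<in> T b}"
    (is "_ \<le> x + card A * card ?D")
proof -
  have "(\<Sum>a\<in>A. card (T a)) = (\<Sum>a\<in>A. \<Sum>t\<in>{1..x}. if t \<in> T a then 1 else 0)"
  proof (rule sum.cong[OF refl])
    fix a assume "a \<in> A"
    then have "{1..x} \<inter> T a = T a" using T by blast
    then show "card (T a) = (\<Sum>t\<in>{1..x}. if t \<in> T a then 1 else 0)" by (simp add: sum.If_cases)
  qed
  also have "\<dots> = (\<Sum>t\<in>{1..x}. \<Sum>a\<in>A. if t \<in> T a then 1 else 0)" by (rule sum.swap)
  also have "\<dots> \<le> (\<Sum>t\<in>{1..x}. 1 + (if t \<in> ?D then card A else 0))"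
  proof (rule sum_mono)
    fix t assume t: "t \<in> {1..x}"
    have e: "(\<Sum>a\<in>A. if t \<in> T a then 1 else 0) = card {a \<in> A. t \<in> T a}"
      using fin by (simp only: card_eq_sum sum.inter_filter)
    show "(\<Sum>a\<in>A. if t \<in> T a then 1 else 0) \<le> 1 + (if t \<in> ?D then card A else 0)"
    proof (cases "t \<in> ?D")
      case True
      have "card {a \<in> A. t \<in> T a} \<le> card A" using fin by (intro card_mono) auto
      then show ?thesis using True e by simp
    next
      case False
      then have "\<forall>a\<in>{a \<in> A. t \<in> T a}. \<forall>b\<in>{a \<in> A. t \<in> T a}. a = b" using t by blast
      then have "card {a \<in> A. t \<in> T a} \<le> Suc 0" using fin by (subst card_le_Suc0_iff_eq) auto
      then show ?thesis using e by simp
    qed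
  qed
  also have "\<dots> = x + card A * card ?D"
  proof -
    have "(\<Sum>t\<in>{1..x}. if t \<in> ?D then card A else 0) = (\<Sum>t\<in>?D. card A)"
      by (simp only: sum.inter_restrict[symmetric] finite_atLeastAtMost) (intro sum.cong, blast, simp)
    also have "\<dots> = card A * card ?D" by (simp only: sum_constant of_nat_id mult.commute)
    finally show ?thesis by (simp only: sum.distrib) simp
  qed
  finally show ?thesis .
qed

text \<open>
  When the sets \<open>large_factor_set y (L div a) x\<close> have total size at least \<open>2 x\<close>, they overlap in at
  least \<open>x / card A\<close> points \<open>t\<close>, and each such \<open>t\<close> yields a sparse product \<open>p * q\<close>. From \<open>a\<close>, \<open>b\<close>, the
  product and the order of its two prime factors one recovers \<open>p\<close> and \<open>q\<close>, then \<open>t\<close> modulo both primes,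
  and finally \<open>t\<close> itself since \<open>t \<le> x < p * q\<close>. So every product arises at most \<open>2 (card A)\<^sup>2\<close> times.
\<close>
lemma card_B_ge_of_overlap:
  fixes A :: "nat set" and x :: nat and y \<epsilon> :: real
  defines "L \<equiv> \<Prod>A"
  assumes A: "finite A" "\<And>a. a \<in> A \<Longrightarrow> 0 < a"
      "\<And>a b. a \<in> A \<Longrightarrow> b \<in> A \<Longrightarrow> a < b \<Longrightarrow> (b - a) dvd a"
    and T: "\<And>a. a \<in> A \<Longrightarrow> 2 * real x \<le> real (card A) * real (card (large_factor_set y (L div a) x))"
    and k: "card A > 0"
    and y: "2 \<le> y" "2 * real L * real x < y\<^sup>2" "4 * real L * real x \<le> (y\<^sup>2) powr (1/2 + \<epsilon>)"
    and e: "0 < \<epsilon>" and N: "(real x)\<^sup>2 \<le> N"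
  shows "real x \<le> 2 * real (card A) ^ 3 * real (card (B \<epsilon> N))"
proof -
  define T where "T = (\<lambda>a. large_factor_set y (L div a) x)"
  define D where "D = {t \<in> {1..x}. \<exists>a\<in>A. \<exists>b\<in>A. a \<noteq> b \<and> t \<in> T a \<and> t \<in> T b}"
  have L0: "L > 0" unfolding L_def using A by (auto intro!: prod_pos)
  have Ldvd: "a dvd L" if "a \<in> A" for a unfolding L_def using A(1) that by (rule dvd_prodI)
  have "x + x \<le> x + card A * card D"
  proof -
    have "2 * x * card A = (\<Sum>a\<in>A. 2 * x)" by simp
    also have "\<dots> \<le> (\<Sum>a\<in>A. card A * card (T a))"
    proof (rule sum_mono)
      fix a assume "a \<in> A"
      from T[OF this] have "real (2 * x) \<le> real (card A * card (T a))" by (simp add: T_def)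
      then show "2 * x \<le> card A * card (T a)" by (simp only: of_nat_le_iff)
    qed
    also have "\<dots> = (\<Sum>a\<in>A. card (T a)) * card A" by (simp add: sum_distrib_left mult.commute)
    finally have "2 * x \<le> (\<Sum>a\<in>A. card (T a))" using k by simp
    also have "\<dots> \<le> x + card A * card D"
      unfolding D_def by (rule double_count_overlap[OF A(1)]) (auto simp: T_def large_factor_set_def)
    finally show ?thesis by simp
  qed
  then have xD: "x \<le> card A * card D" by simp
  define good where "good = (\<lambda>t (a, b, p, q). a \<in> A \<and> b \<in> A \<and> a < b \<and> prime p \<and> prime q \<and>
    y < real p \<and> y < real q \<and> p \<le> x \<and> q \<le> x \<and> p dvd (L div a) * t + 1 \<and> q dvd (L div b) * t + 1)"
  have "\<exists>w. good t w" if t: "t \<in> D" for t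
  proof -
    obtain a b where ab: "a \<in> A" "b \<in> A" "a \<noteq> b" "t \<in> T a" "t \<in> T b" using t by (auto simp: D_def)
    define a' b' where "a' = min a b" and "b' = max a b"
    have ab': "a' \<in> A" "b' \<in> A" "a' < b'" "t \<in> T a'" "t \<in> T b'"
      using ab by (auto simp: a'_def b'_def min_def max_def)
    obtain p where "prime p" "y < real p" "p \<le> x" "p dvd (L div a') * t + 1"
      using ab'(4) unfolding T_def large_factor_set_def by blast
    moreover obtain q where "prime q" "y < real q" "q \<le> x" "q dvd (L div b') * t + 1"
      using ab'(5) unfolding T_def large_factor_set_def by blast
    ultimately have "good t (a', b', p, q)" using ab' by (simp add: good_def)
    then show ?thesis by blast
  qed
  then obtain w where w: "\<And>t. t \<in> D \<Longrightarrow> good t (w t)" by metis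
  have large: "y * y \<le> real (p * q)" if "y < real p" "y < real q" for p q :: nat
    using that y by (simp add: mult_mono)
  have ordered: "p \<noteq> q \<and> p * q \<in> B \<epsilon> N" if t: "t \<in> D" and g: "good t (a, b, p, q)" for t a b p q
  proof -
    have g': "a \<in> A" "b \<in> A" "a < b" "prime p" "prime q" "y < real p" "y < real q" "p \<le> x" "q \<le> x"
      "p dvd (L div a) * t + 1" "q dvd (L div b) * t + 1"
      using g by (simp_all add: good_def)
    have tx: "1 \<le> t" "t \<le> x" using t by (simp_all add: D_def)
    have "b \<le> L" using Ldvd[OF g'(2)] L0 by (rule dvd_imp_le)
    have Lb: "b * (L div b) = L" using Ldvd[OF g'(2)] by simp
    have "b * ((L div b) * t + 1) = L * t + b"
      by (simp only: distrib_left mult.assoc [symmetric] Lb mult_1_right)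
    moreover have "L * t \<le> L * x" "L * 1 \<le> L * x" using tx by (intro mult_le_mono2; simp)+
    ultimately have le: "b * ((L div b) * t + 1) \<le> 2 * (L * x)" using \<open>b \<le> L\<close> by linarith
    have pq: "y\<^sup>2 \<le> real (p * q)" using large[OF g'(6,7)] by (simp add: power2_eq_square)
    have "real (2 * (L * x)) < real (p * q)" using y(2) pq by simp
    then have "2 * (L * x) < p * q" by (simp only: of_nat_less_iff)
    then have small: "b * ((L div b) * t + 1) < p * q" using le by linarith
    have Leq: "a * (L div a) = b * (L div b)" using Ldvd g' by simp
    note th = theta_le_of_consecutive_multiples[OF g'(4,10) g'(5,11) A(2)[OF g'(1)] g'(3)
      A(3)[OF g'(1,2,3)] Leq small]
    have "real (theta (p * q)) < real (4 * (L * x))" using th(2) le by (simp only: of_nat_less_iff)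
    also have "\<dots> \<le> (y\<^sup>2) powr (1/2 + \<epsilon>)" using y(3) by simp
    also have "\<dots> \<le> real (p * q) powr (1/2 + \<epsilon>)" using pq e by (intro powr_mono2) auto
    finally have "real (theta (p * q)) < real (p * q) powr (1/2 + \<epsilon>)" .
    moreover have "binary (p * q)"
    proof -
      have "p > 2" "q > 2" using g' y by linarith+
      then have "odd p" "odd q" using g' prime_odd_nat by blast+
      then show ?thesis using g' th(1) unfolding binary_def by blast
    qed
    moreover have "real (p * q) < N"
    proof -
      have "p * q < x * x"
      proof (cases "p < x")
        case True
        then show ?thesis using g' prime_gt_0_nat[OF g'(5)] by (intro mult_less_le_imp_less) auto
      next
        case False
        then have "q < x" using g' th(1) by simp
        then show ?thesis using g' prime_gt_0_nat[OF g'(4)] by (intro mult_le_less_imp_less) auto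
      qed
      then have "real (p * q) < real (x * x)" by (simp only: of_nat_less_iff)
      then show ?thesis using N by (simp add: power2_eq_square)
    qed
    ultimately show ?thesis using th(1) by (simp add: B_def)
  qed
  \<comment> \<open>The order bit \<open>p < q\<close> is needed since \<open>p\<close> and \<open>q\<close> play different roles for \<open>t\<close>.\<close>
  define code where "code = (\<lambda>(a::nat, b::nat, p::nat, q::nat). (a, b, p < q, p * q))"
  have "card D \<le> card (A \<times> A \<times> (UNIV :: bool set) \<times> B \<epsilon> N)"
  proof (rule card_inj_on_le[of "\<lambda>t. code (w t)"])
    show "inj_on (\<lambda>t. code (w t)) D"
    proof (rule inj_onI)
      fix t t' assume t: "t \<in> D" "t' \<in> D" and eq: "code (w t) = code (w t')"
      obtain a b p q where wt: "w t = (a, b, p, q)" by (cases "w t")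
      obtain a' b' p' q' where wt': "w t' = (a', b', p', q')" by (cases "w t'")
      have g: "good t (a, b, p, q)" "good t' (a', b', p', q')" using w[OF t(1)] w[OF t(2)] wt wt' by simp_all
      have c: "a = a'" "b = b'" "p < q \<longleftrightarrow> p' < q'" "p * q = p' * q'"
        using eq by (simp_all add: wt wt' code_def)
      have pr: "prime p" "prime q" "prime p'" "prime q'" using g by (simp_all add: good_def)
      have ne: "p \<noteq> q" "p' \<noteq> q'" using ordered[OF t(1) g(1)] ordered[OF t(2) g(2)] by simp_all
      have "p = p' \<and> q = q'" using prime_pair_eq[OF pr c(4) ne c(3)] .
      then have dv: "p dvd (L div a) * t + 1" "q dvd (L div b) * t + 1"
          "p dvd (L div a) * t' + 1" "q dvd (L div b) * t' + 1"
        using g c by (simp_all add: good_def)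
      have "[t = t'] (mod p)" using pr(1) dv(1,3) by (rule cong_of_common_prime_divisor)
      moreover have "[t = t'] (mod q)" using pr(2) dv(2,4) by (rule cong_of_common_prime_divisor)
      ultimately have cong: "[t = t'] (mod p * q)"
        using primes_coprime[OF pr(1,2) ne(1)] by (intro coprime_cong_mult_nat)
      have "x < p * q"
      proof -
        have "y * y \<le> real (p * q)" using g by (intro large) (simp_all add: good_def)
        moreover have "1 * real x \<le> 2 * real L * real x" using L0 by (intro mult_right_mono) auto
        ultimately have "real x < real (p * q)" using y(2) by (simp add: power2_eq_square)
        then show ?thesis by (simp only: of_nat_less_iff)
      qed
      then have "t < p * q" "t' < p * q" using t by (simp_all add: D_def)
      then show "t = t'" using cong by (simp add: cong_less_modulus_unique_nat)
    qed
    show "(\<lambda>t. code (w t)) ` D \<subseteq> A \<times> A \<times> UNIV \<times> B \<epsilon> N"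
    proof (rule image_subsetI)
      fix t assume t: "t \<in> D"
      obtain a b p q where wt: "w t = (a, b, p, q)" by (cases "w t")
      have g: "good t (a, b, p, q)" using w[OF t] wt by simp
      then show "code (w t) \<in> A \<times> A \<times> UNIV \<times> B \<epsilon> N"
        using ordered[OF t g] by (simp add: wt code_def good_def)
    qed
    show "finite (A \<times> A \<times> (UNIV :: bool set) \<times> B \<epsilon> N)" using A(1) finite_B by simp
  qed
  then have "card D \<le> 2 * (card A * card A) * card (B \<epsilon> N)" by (simp add: card_cartesian_product mult_ac)
  then have "x \<le> card A * (2 * (card A * card A) * card (B \<epsilon> N))"
    using xD mult_le_mono2 order.trans by blast
  then have "real x \<le> real (card A * (2 * (card A * card A) * card (B \<epsilon> N)))" by (simp only: of_nat_le_iff)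
  then show ?thesis by (simp add: power3_eq_cube mult_ac)
qed

lemma card_B_lower:
  fixes \<epsilon> :: real
  assumes e: "0 < \<epsilon>" "\<epsilon> < 1/2"
  shows "\<exists>c>0. \<forall>\<^sub>F N in at_top. c * N powr (1/2) \<le> real (card (B \<epsilon> N))"
proof -
  \<comment> \<open>Any \<open>\<delta> < 1/2\<close> with \<open>(1 - \<delta>)(1 + 2\<epsilon>) > 1\<close> works: then \<open>pq \<ge> x powr (2 - 2\<delta>)\<close> makes \<open>(pq) powr (1/2 + \<epsilon>)\<close> outgrow \<open>x\<close>.\<close>
  define \<delta> where "\<delta> = \<epsilon> / 2"
  have d: "0 < \<delta>" "\<delta> < 1/2" using e by (simp_all add: \<delta>_def)
  \<comment> \<open>\<open>k\<close> sets of density \<open>\<delta> / 4\<close> then have total density at least \<open>2\<close>.\<close>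
  obtain k :: nat where k: "8 / \<delta> < real k" using reals_Archimedean2 by blast
  then have k0: "k > 0" using d by (cases k) (auto simp: field_simps)
  obtain A :: "nat set" where A: "finite A" "card A = k" "\<And>a. a \<in> A \<Longrightarrow> 0 < a"
    and dv: "\<And>a b. a \<in> A \<Longrightarrow> b \<in> A \<Longrightarrow> a < b \<Longrightarrow> (b - a) dvd a"
    using exists_difference_divides_set[of k] by blast
  define L where "L = \<Prod>A"
  have L0: "L > 0" unfolding L_def using A by (auto intro!: prod_pos)
  have expo: "2 * (1 - \<delta>) > 1" "2 * (1 - \<delta>) * (1/2 + \<epsilon>) > 1"
  proof -
    show "2 * (1 - \<delta>) > 1" using d by simp
    have "2 * (1 - \<delta>) * (1/2 + \<epsilon>) = 1 + \<epsilon> * (3/2 - \<epsilon>)" by (simp add: \<delta>_def field_simps)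
    moreover have "\<epsilon> * (3/2 - \<epsilon>) > 0" using e by (intro mult_pos_pos) auto
    ultimately show "2 * (1 - \<delta>) * (1/2 + \<epsilon>) > 1" by linarith
  qed
  have "\<forall>\<^sub>F x::nat in sequentially. \<forall>a\<in>A.
      \<delta> / 4 * real x \<le> real (card (large_factor_set (real x powr (1 - \<delta>)) (L div a) x))"
  proof (rule eventually_ball_finite[OF A(1)], rule ballI)
    fix a assume a: "a \<in> A"
    have "a dvd L" unfolding L_def using A(1) a by (rule dvd_prodI)
    then have "L div a > 0" using L0 A(3)[OF a] by (simp add: div_greater_zero_iff dvd_imp_le)
    then show "\<forall>\<^sub>F x::nat in sequentially.
        \<delta> / 4 * real x \<le> real (card (large_factor_set (real x powr (1 - \<delta>)) (L div a) x))"
      using d by (intro card_large_factor_set_linear)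
  qed
  moreover have "\<forall>\<^sub>F x::nat in sequentially. 2 \<le> real x powr (1 - \<delta>)" using d by real_asymp
  moreover have "\<forall>\<^sub>F x::nat in sequentially. 3 * real L * real x \<le> real x powr (2 * (1 - \<delta>))"
    using expo L0 by (intro eventually_linear_le_powr) auto
  moreover have "\<forall>\<^sub>F x::nat in sequentially. 4 * real L * real x \<le> real x powr (2 * (1 - \<delta>) * (1/2 + \<epsilon>))"
    using expo L0 by (intro eventually_linear_le_powr) auto
  moreover have "\<forall>\<^sub>F x::nat in sequentially. x \<ge> 1" by (rule eventually_ge_at_top)
  ultimately have "\<forall>\<^sub>F x::nat in sequentially.
      \<forall>N. (real x)\<^sup>2 \<le> N \<longrightarrow> real x \<le> 2 * real k ^ 3 * real (card (B \<epsilon> N))"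
  proof eventually_elim
    case (elim x)
    define y where "y = real x powr (1 - \<delta>)"
    have sq: "y\<^sup>2 = real x powr (2 * (1 - \<delta>))"
      by (simp add: y_def power2_eq_square powr_add [symmetric])
    show ?case
    proof (intro allI impI)
      fix N assume N: "(real x)\<^sup>2 \<le> N"
      have big: "2 * real x \<le> real (card A) * real (card (large_factor_set y (\<Prod>A div a) x))" if a: "a \<in> A" for a
      proof -
        have "8 \<le> real k * \<delta>" using k d by (simp add: field_simps)
        then have "2 * real x \<le> real k * \<delta> / 4 * real x" by (intro mult_right_mono) auto
        also have "\<dots> = real k * (\<delta> / 4 * real x)" by simp
        also have "\<dots> \<le> real k * real (card (large_factor_set y (L div a) x))"
          using elim(1) a unfolding y_def by (intro mult_left_mono) auto
        finally show ?thesis by (simp add: A(2) L_def)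
      qed
      have "real L * real x > 0" using L0 elim by simp
      then have "2 * real L * real x < y\<^sup>2" using elim(3) unfolding sq by linarith
      moreover have "4 * real L * real x \<le> (y\<^sup>2) powr (1/2 + \<epsilon>)" using elim(4) by (simp add: sq powr_powr)
      ultimately have "real x \<le> 2 * real (card A) ^ 3 * real (card (B \<epsilon> N))"
        using A(1,3) dv big k0 elim(2) e N unfolding L_def y_def [symmetric]
        by (intro card_B_ge_of_overlap[where y = y]) (simp_all add: A(2) y_def)
      then show "real x \<le> 2 * real k ^ 3 * real (card (B \<epsilon> N))" by (simp add: A(2))
    qed
  qed
  then obtain x0 where x0: "\<And>x N. x \<ge> x0 \<Longrightarrow> (real x)\<^sup>2 \<le> N \<Longrightarrow>
      real x \<le> 2 * real k ^ 3 * real (card (B \<epsilon> N))"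
    unfolding eventually_sequentially by blast
  define c where "c = 1 / (4 * real k ^ 3)"
  have c: "c > 0" using k0 by (simp add: c_def)
  have "\<forall>\<^sub>F N in at_top. N \<ge> (real x0 + 2)\<^sup>2" by (rule eventually_ge_at_top)
  then have "\<forall>\<^sub>F N in at_top. c * N powr (1/2) \<le> real (card (B \<epsilon> N))"
  proof eventually_elim
    case (elim N)
    have N0: "N > 0" using elim by (smt (verit) of_nat_0_le_iff zero_less_power)
    have s: "sqrt N \<ge> real x0 + 2" using elim by (simp add: real_le_rsqrt)
    define x where "x = nat \<lfloor>sqrt N\<rfloor>"
    have x1: "real x \<le> sqrt N" "sqrt N \<le> 2 * real x" "x \<ge> x0" using s unfolding x_def by linarith+
    have "(real x)\<^sup>2 \<le> (sqrt N)\<^sup>2" using x1(1) by (rule power_mono) simp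
    then have "(real x)\<^sup>2 \<le> N" using N0 by simp
    then have "real x \<le> 2 * real k ^ 3 * real (card (B \<epsilon> N))" using x0 x1(3) by blast
    then have "sqrt N \<le> 4 * real k ^ 3 * real (card (B \<epsilon> N))" using x1(2) by linarith
    then have "c * sqrt N \<le> real (card (B \<epsilon> N))" using k0 by (simp add: c_def field_simps)
    then show ?case using N0 by (simp add: powr_half_sqrt)
  qed
  then show ?thesis using c by blast
qed

section \<open>The asymptotic statements\<close>

lemma bigo_of_upper:
  assumes "\<exists>C>0. \<forall>N>0. real (card (B \<epsilon> N)) \<le> C * N powr \<alpha>"
  shows "(\<lambda>N::real. real (card (B \<epsilon> N))) \<in> O(\<lambda>N. N powr \<alpha>)"
proof -
  obtain C where "C > 0" and C: "\<And>N. N > 0 \<Longrightarrow> real (card (B \<epsilon> N)) \<le> C * N powr \<alpha>" using assms by blast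
  have "\<forall>\<^sub>F N::real in at_top. N > 0" by (rule eventually_gt_at_top)
  then have "\<forall>\<^sub>F N in at_top. norm (real (card (B \<epsilon> N))) \<le> C * norm (N powr \<alpha>)"
    by eventually_elim (use C in simp)
  then show ?thesis by (rule bigoI)
qed

theorem mainTheorem1:
  shows "(\<forall>\<epsilon>::real. 0 < \<epsilon> \<and> \<epsilon> < 1/2 \<longrightarrow>
            (\<lambda>N::real. real (card (B \<epsilon> N))) \<in> \<Omega>[at_top](\<lambda>N. N powr (1/2))) \<and>
         (\<forall>\<epsilon>::real. 0 < \<epsilon> \<and> \<epsilon> < 1/6 \<longrightarrow>
            (\<lambda>N::real. real (card (B \<epsilon> N))) \<in> O[at_top](\<lambda>N. N powr (1/2 + \<epsilon>))) \<and>
         (\<forall>\<epsilon>::real. 0 < \<epsilon> \<and> \<epsilon> < 1/2 \<longrightarrow>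
            (\<lambda>N::real. real (card (B \<epsilon> N))) \<in> O[at_top](\<lambda>N. N / (ln N)\<^sup>2))"
proof (intro conjI allI impI; elim conjE)
  fix \<epsilon> :: real assume e: "0 < \<epsilon>" "\<epsilon> < 1/2"
  obtain c where c: "c > 0" "\<forall>\<^sub>F N in at_top. c * N powr (1/2) \<le> real (card (B \<epsilon> N))"
    using card_B_lower[OF e] by blast
  from c(2) have "\<forall>\<^sub>F N in at_top. norm (real (card (B \<epsilon> N))) \<ge> c * norm (N powr (1/2))"
    by eventually_elim simp
  then show "(\<lambda>N::real. real (card (B \<epsilon> N))) \<in> \<Omega>[at_top](\<lambda>N. N powr (1/2))"
    by (rule landau_omega.bigI[OF c(1)])
next
  fix \<epsilon> :: real assume "0 < \<epsilon>" "\<epsilon> < 1/6"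
  then show "(\<lambda>N::real. real (card (B \<epsilon> N))) \<in> O[at_top](\<lambda>N. N powr (1/2 + \<epsilon>))"
    by (intro bigo_of_upper card_B_upper) auto
next
  fix \<epsilon> :: real assume e: "0 < \<epsilon>" "\<epsilon> < 1/2"
  have "(\<lambda>N::real. real (card (B \<epsilon> N))) \<in> O(\<lambda>N. N powr (1/2 + \<epsilon>))"
    by (intro bigo_of_upper card_B_upper e)
  also have "(\<lambda>N. N powr (1/2 + \<epsilon>)) \<in> O(\<lambda>N. N / (ln N)\<^sup>2)"
    by (rule powr_bigo_div_ln_squared) (use e in simp)
  finally show "(\<lambda>N::real. real (card (B \<epsilon> N))) \<in> O[at_top](\<lambda>N. N / (ln N)\<^sup>2)" .
qed

end
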